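(* For every $n\ge1$, the map $\phi:\mathcal{M}_n\to\mathcal{M}_n$ is a bijection, and $ne(\phi(M))=st(M)$ for every $M\in\mathcal{M}_n$.
   Context: A matching on $[2n]$ is a partition of $\{1,\dots,2n\}$ into $n$ two-element blocks (edges), written $(a,b)$ with $a<b$; $\mathcal{M}_n$ is the set of them. Edges $(a,b),(c,d)$ with $a<c$ are crossed if $a<c<b<d$, nested if $a<c<d<b$, aligned otherwise. $ne(M)$ is the number of nested pairs of edges of $M$. The statistic $st$: order the edges $e_1,\dots,e_n$ of $M$ by increasing left endpoints; if $e_i=(a,b)$ and $e_{i+1}=(c,d)$ are nested, $st_i(M)$ is the number of vertices $v$ with $d\le v\le b$ that belong to some edge $e_k$ with $k>i$; otherwise $st_i(M)=0$; $st(M)=\sum_{i=1}^{n-1}st_i(M)$. The map $\phi$ is defined recursively. If $n=1$, $\phi(M)=M$. If $n>1$, let $e_1=(1,r)$ be the first edge of $M$ and $e_2$ the second edge of $M$ (ordered by left endpoints). Let $M_1$ be the matching obtained by deleting $e_1$ (and its vertices) from $M$ and renumbering to $[2n-2]$ order-preservingly; let $N_1=\phi(M_1)$; let $N_2$ be the matching on $[2n]$ obtained by putting back the vertices $1,r$ and the edge $e_1=(1,r)$ in their original positions (so $N_2$ restricted to $[2n]\setminus\{1,r\}$ is $N_1$ transported order-preservingly). Three cases, according to the relation of $e_1,e_2$ in $M$: Case 1 ($e_1,e_2$ aligned): $\phi(M)=N_2$. Case 2 ($e_1,e_2$ crossed): let $f_2=e_2=(l_2,r_2),f_3=(l_3,r_3),\dots,f_k=(l_k,r_k)$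 be the edges of $N_2$ crossing $e_1$, with $2=l_2<l_3<\dots<l_k$. Remove these edges and instead connect $r_2$ to $l_3$, $r_3$ to $l_4$, ..., $r_{k-1}$ to $l_k$; insert one new vertex immediately before $r$ and connect it to $r_k$; delete the vertex $l_2$ and renumber the vertices to $[2n]$ order-preservingly. The result is $\phi(M)$. Case 3 ($e_1,e_2$ nested, $e_2=(2,q)$ with $q<r$): in $N_2$ let $f_1=(l_1,r_1),\dots,f_p=(l_p,r_p)$ be the edges crossing both $e_1$ and $e_2$, and $f_{p+1}=(l_{p+1},r_{p+1}),\dots,f_{p+s}=(l_{p+s},r_{p+s})$ the edges crossing $e_1$ but not $e_2$, with $l_1<\dots<l_p<q<l_{p+1}<\dots<l_{p+s}$; write $\{l_1,\dots,l_p,q,l_{p+1},\dots,l_{p+s}\}=\{v_1<v_2<\dots<v_{p+s+1}\}$. Remove the edges $e_2,f_1,\dots,f_{p+s}$; insert one new vertex immediately before $r$ and connect it to $v_{s+1}$; connect $r_1,\dots,r_{p+s}$ respectively to $v_1,\dots,v_s,v_{s+2},\dots,v_{p+s+1}$ (in that order); delete the vertex $2$ and renumber the vertices to $[2n]$ order-preservingly. The result is $\phi(M)$. *)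

theory Defs
  imports Main "HOL-Library.Disjoint_Sets"
begin

text \<open>
  An edge with endpoints \<open>a < b\<close> is the pair \<open>(a, b)\<close>, and a matching is the set of its edges.
\<close>

type_synonym edge = "nat \<times> nat"

definition matchings :: "nat \<Rightarrow> edge set set" where
  "matchings n = {M. (\<forall>(a, b)\<in>M. a < b) \<and> card M = n \<and>
     partition_on {1..2 * n} ((\<lambda>(a, b). {a, b}) ` M)}"

text \<open>
  Crossing is symmetric in the two edges; for nesting the first argument is the edge with the
  smaller left endpoint, so every nested pair is counted once in \<open>ne\<close>.
\<close>

fun crossed :: "edge \<Rightarrow> edge \<Rightarrow> bool" where
  "crossed (a, b) (c, d) \<longleftrightarrow> a < c \<and> c < b \<and> b < d \<or> c < a \<and> a < d \<and> d < b"

fun nested :: "edge \<Rightarrow> edge \<Rightarrow> bool" where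
  "nested (a, b) (c, d) \<longleftrightarrow> a < c \<and> c < d \<and> d < b"

definition ne :: "edge set \<Rightarrow> nat" where
  "ne M = card {(e, f). e \<in> M \<and> f \<in> M \<and> nested e f}"

definition by_left :: "edge set \<Rightarrow> edge list" where
  "by_left M = sorted_key_list_of_set fst M"

text \<open>
  List positions start at 0, so \<open>by_left M ! i\<close> is the edge $e_{i+1}$ and \<open>st_at M i\<close> is
  $st_{i+1}(M)$.
\<close>

definition st_at :: "edge set \<Rightarrow> nat \<Rightarrow> nat" where
  "st_at M i =
    (let es = by_left M in
     if nested (es ! i) (es ! Suc i)
     then card {v. snd (es ! Suc i) \<le> v \<and> v \<le> snd (es ! i) \<and>
                   (\<exists>k>i. k < length es \<and> v \<in> {fst (es ! k), snd (es ! k)})}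
     else 0)"

definition st :: "edge set \<Rightarrow> nat" where
  "st M = (\<Sum>i<card M - 1. st_at M i)"

text \<open>
  \<open>open_gap p\<close> is the order-preserving renumbering that frees the position \<open>p\<close>, where a new vertex
  is put immediately before the vertex formerly numbered \<open>p\<close>. \<open>close_gap p\<close> is the order-preserving
  renumbering after deletion of the vertex \<open>p\<close>.
\<close>

definition open_gap :: "nat \<Rightarrow> nat \<Rightarrow> nat" where
  "open_gap p v = (if v < p then v else v + 1)"

definition close_gap :: "nat \<Rightarrow> nat \<Rightarrow> nat" where
  "close_gap p v = (if v < p then v else v - 1)"

definition relabel :: "(nat \<Rightarrow> nat) \<Rightarrow> edge set \<Rightarrow> edge set" where
  "relabel g M = map_prod g g ` M"

definition remove_edge1 :: "nat \<Rightarrow> edge set \<Rightarrow> edge set" where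
  "remove_edge1 r M = relabel (close_gap 1 \<circ> close_gap r) (M - {(1, r)})"

definition put_back_edge1 :: "nat \<Rightarrow> edge set \<Rightarrow> edge set" where
  "put_back_edge1 r N = insert (1, r) (relabel (open_gap r \<circ> open_gap 1) N)"

text \<open>
  In both operations below the new vertex receives the number \<open>r\<close>, and only then the vertex 2 is
  deleted. In \<open>cross_step\<close>, the lists \<open>ls\<close> and \<open>rs\<close> are $l_2, \dots, l_k$ and $r_2, \dots, r_k$.
\<close>

definition cross_step :: "nat \<Rightarrow> edge set \<Rightarrow> edge set" where
  "cross_step r N =
    (let F = {f \<in> N. crossed (1, r) f};
         ls = map fst (by_left F);
         rs = map snd (by_left F);
         K = (N - F) \<union> set (zip (tl ls) (butlast rs))
     in relabel (close_gap 2) (insert (r, open_gap r (last rs)) (relabel (open_gap r) K)))"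

text \<open>
  In \<open>nest_step\<close>, the lists \<open>rs\<close> and \<open>vs\<close> are $r_1, \dots, r_{p+s}$ and $v_1, \dots, v_{p+s+1}$, so
  \<open>vs ! s\<close> is $v_{s+1}$.
\<close>

definition nest_step :: "nat \<Rightarrow> nat \<Rightarrow> edge set \<Rightarrow> edge set" where
  "nest_step r q N =
    (let F = {f \<in> N. crossed (1, r) f};
         s = card {f \<in> F. \<not> crossed (2, q) f};
         rs = map snd (by_left F);
         vs = sorted_list_of_set (insert q (fst ` F));
         K = (N - insert (2, q) F) \<union> set (zip (take s vs @ drop (Suc s) vs) rs)
     in relabel (close_gap 2) (insert (open_gap r (vs ! s), r) (relabel (open_gap r) K)))"

text \<open>
  The first argument of \<open>phi\<close> is the number of edges; the value at 0 is irrelevant.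
\<close>

fun phi :: "nat \<Rightarrow> edge set \<Rightarrow> edge set" where
  "phi 0 M = M"
| "phi (Suc 0) M = M"
| "phi (Suc (Suc n)) M =
    (let e1 = by_left M ! 0;
         e2 = by_left M ! 1;
         r = snd e1;
         N = put_back_edge1 r (phi (Suc n) (remove_edge1 r M))
     in if crossed e1 e2 then cross_step r N
        else if nested e1 e2 then nest_step r (snd e2) N
        else N)"

end

theory Submission
  imports Defs
begin

text \<open>
  In a matching with first edge $(1,r)$, the edges crossing $(1,r)$ have their left endpoints in a
  set $L$ of vertices below $r$ and their right endpoints above $r$. Both nontrivial steps of $\phi$
  keep the sequence of right endpoints, listed by increasing left endpoint, and only move the set
  $L$: in the crossing case the vertex 2 is exchanged for a new vertex just before $r$; in the nested
  case, with $e_2=(2,q)$ and $V=L\cup\{q\}$, the set $V\setminus\{q\}$ is replaced by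
  $V\setminus\{v\}$, where as many elements of $V$ lie below $v$ as lie above $q$, and $(2,q)$ is
  replaced by an edge from $v$ to the new vertex. Hence the number of nestings among the crossing
  edges does not change, every other nesting count is a sum over the left endpoints, and comparing
  these sums gives a change of $0$ and of $r-q$, respectively, relative to the matching without
  $e_1$. This is the contribution of $e_1$ to $st$.

  Each step can be undone, since $v$ determines $q$ in $V$; and the partner of the vertex $r-1$ in the
  image shows which case was applied. So $\phi$ is injective on the finite set of matchings.
\<close>

subsection \<open>Matchings on arbitrary vertex sets\<close>

text \<open>The case distinction looks at the second edge of \<open>M\<close>, but the modification
  acts on \<open>N\<close>, whose edges other than (1, r) come from the recursive call. The two fit
  together because \<open>phi\<close> never changes the edge at the vertex 1. This invariant is
  carried through the induction, and it also allows the injectivity argument to compare two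
  matchings with the same r. The second edge starts at 2 unless r = 2, so the aligned case is
  exactly r = 2.

  The position of v is forced by counting. The number r - q is 1 plus the number of vertices
  strictly between q and r, and such a vertex is of one of three kinds. Left endpoints of crossing
  edges are paid for by the crossing edges that contain the new edge at v. These are the ones
  starting below v, so as many elements of V have to lie below v as lie above q. Left endpoints of
  other edges are paid for by q joining the set of left endpoints. Right endpoints of other edges
  are paid for by the edges contained in (1, r) but not in (2, q).\<close>

lemma (in linorder) sorted_key_list_of_set_props:
  assumes "finite A" "inj_on f A"
  shows "set (sorted_key_list_of_set f A) = A"
    "sorted_wrt (<) (map f (sorted_key_list_of_set f A))"
    "length (sorted_key_list_of_set f A) = card A"
proof -
  interpret folding_insort_key "(\<le>)" "(<)" A f
    by standard (use assms in auto)
  show "set (sorted_key_list_of_set f A) = A"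
    "sorted_wrt (<) (map f (sorted_key_list_of_set f A))"
    "length (sorted_key_list_of_set f A) = card A"
    using assms(1) by simp_all
qed

lemma (in linorder) sorted_key_list_of_set_set:
  assumes "sorted_wrt (<) (map f xs)"
  shows "sorted_key_list_of_set f (set xs) = xs"
proof -
  have d: "distinct (map f xs)" "sorted (map f xs)"
    using assms by (simp_all add: strict_sorted_iff)
  interpret folding_insort_key "(\<le>)" "(<)" "set xs" f
    by standard (use d in \<open>simp add: distinct_map\<close>)
  show ?thesis
    using d by (simp add: idem_if_sorted_distinct distinct_map)
qed

lemma by_left_props:
  assumes "finite M" "inj_on fst M"
  shows "set (by_left M) = M" "sorted_wrt (<) (map fst (by_left M))"
    "length (by_left M) = card M"
  using sorted_key_list_of_set_props[OF assms] by (simp_all add: by_left_def)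

lemma by_left_unique: "sorted_wrt (<) (map fst xs) \<Longrightarrow> by_left (set xs) = xs"
  by (simp add: by_left_def sorted_key_list_of_set_set)

text \<open>Within a step the vertices form an interval with one number missing, and parts of a
  matching live on smaller sets still, so the vertex set is a parameter. Conditions on the two
  projections replace the partition into blocks because they behave well under unions, differences
  and relabelling.\<close>

definition perfect :: "nat set \<Rightarrow> edge set \<Rightarrow> bool" where
  "perfect S M \<longleftrightarrow> (\<forall>(a, b)\<in>M. a < b) \<and> inj_on fst M \<and> inj_on snd M \<and>
     fst ` M \<inter> snd ` M = {} \<and> fst ` M \<union> snd ` M = S"

lemma perfect_less: "perfect S M \<Longrightarrow> (a, b) \<in> M \<Longrightarrow> a < b"
  by (auto simp: perfect_def)

lemma perfectD:
  assumes "perfect S M"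
  shows "\<forall>(a, b)\<in>M. a < b" "inj_on fst M" "inj_on snd M" "fst ` M \<inter> snd ` M = {}"
    "fst ` M \<union> snd ` M = S" "fst ` M \<subseteq> S" "snd ` M \<subseteq> S"
  using assms by (auto simp only: perfect_def)

lemma endpoint_image:
  assumes "(a, b) \<in> M"
  shows "a \<in> fst ` M" "b \<in> snd ` M"
  using image_eqI[OF _ assms, of a fst] image_eqI[OF _ assms, of b snd] by simp_all

lemma perfect_vertex:
  assumes "perfect S M" "(a, b) \<in> M"
  shows "a \<in> S \<and> b \<in> S"
  using assms(1) endpoint_image[OF assms(2)] unfolding perfect_def by blast

lemma perfect_subset: "perfect S M \<Longrightarrow> M \<subseteq> S \<times> S"
  using perfect_vertex by auto

lemma perfect_inj: "perfect S M \<Longrightarrow> inj_on fst M" "perfect S M \<Longrightarrow> inj_on snd M"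
  by (simp_all add: perfect_def)

lemma perfect_fst_unique: "perfect S M \<Longrightarrow> (a, b) \<in> M \<Longrightarrow> (a, c) \<in> M \<Longrightarrow> b = c"
  by (metis fst_conv inj_onD perfect_inj(1) snd_conv)

lemma perfect_snd_unique: "perfect S M \<Longrightarrow> (a, b) \<in> M \<Longrightarrow> (c, b) \<in> M \<Longrightarrow> a = c"
  by (metis fst_conv inj_onD perfect_inj(2) snd_conv)

lemma perfect_fst_snd:
  assumes "perfect S M" "(a, b) \<in> M" "(c, a) \<in> M"
  shows False
  using assms(1) endpoint_image(1)[OF assms(2)] endpoint_image(2)[OF assms(3)]
  unfolding perfect_def by blast

lemma perfect_cover:
  assumes "perfect S M" "v \<in> S"
  shows "\<exists>w. (v, w) \<in> M \<or> (w, v) \<in> M"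
proof -
  have "v \<in> fst ` M \<union> snd ` M" using assms by (simp add: perfect_def)
  then show ?thesis by auto
qed

lemma perfect_finite: "perfect S M \<Longrightarrow> finite S \<Longrightarrow> finite M"
  by (metis finite_Un finite_imageD perfect_def)

lemma perfect_card: 
  assumes "perfect S M" "finite S"
  shows "card S = 2 * card M"
proof -
  have "finite M" using assms by (rule perfect_finite)
  then have "card (fst ` M \<union> snd ` M) = card (fst ` M) + card (snd ` M)"
    using assms by (intro card_Un_disjoint) (auto simp: perfect_def)
  then show ?thesis
    using assms by (simp add: perfect_def card_image)
qed

lemma Union_edges: "\<Union>((\<lambda>(a, b). {a, b}) ` M) = fst ` M \<union> snd ` M"
  by (auto simp: endpoint_image)

text \<open>Disjointness of blocks means that edges sharing a vertex have equal blocks, and the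
  orientation a < b then makes them equal as pairs. Conversely, the number of edges is half the
  number of vertices.\<close>

lemma matchings_iff_perfect: "M \<in> matchings n \<longleftrightarrow> perfect {1..2 * n} M"
proof
  let ?h = "\<lambda>(a, b). {a, b :: nat}"
  assume "M \<in> matchings n"
  then have lt: "\<And>a b. (a, b) \<in> M \<Longrightarrow> a < b"
    and U: "\<Union>(?h ` M) = {1..2 * n}" and D: "disjoint (?h ` M)"
    by (auto simp: matchings_def partition_on_def)
  have eq: "a = c \<and> b = d" if "(a, b) \<in> M" "(c, d) \<in> M" "{a, b} \<inter> {c, d} \<noteq> {}" for a b c d
  proof -
    have "{a, b} \<in> ?h ` M" by (rule rev_image_eqI[OF that(1)]) simp
    moreover have "{c, d} \<in> ?h ` M" by (rule rev_image_eqI[OF that(2)]) simp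
    ultimately have "{a, b} = {c, d}" using D that(3) by (meson disjointD)
    then show ?thesis using lt[OF that(1)] lt[OF that(2)] by (auto simp: doubleton_eq_iff)
  qed
  have "inj_on fst M"
  proof (rule inj_onI)
    fix e f assume ef: "e \<in> M" "f \<in> M" "fst e = fst f"
    then have "{fst e, snd e} \<inter> {fst f, snd f} \<noteq> {}" by simp
    with ef show "e = f"
      using eq[of "fst e" "snd e" "fst f" "snd f", unfolded prod.collapse] by (metis prod_eqI)
  qed
  moreover have "inj_on snd M"
  proof (rule inj_onI)
    fix e f assume ef: "e \<in> M" "f \<in> M" "snd e = snd f"
    then have "{fst e, snd e} \<inter> {fst f, snd f} \<noteq> {}" by simp
    with ef show "e = f"
      using eq[of "fst e" "snd e" "fst f" "snd f", unfolded prod.collapse] by (metis prod_eqI)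
  qed
  moreover have "x \<notin> snd ` M" if "x \<in> fst ` M" for x
  proof
    assume "x \<in> snd ` M"
    with that obtain y z where "(x, y) \<in> M" "(z, x) \<in> M" by auto
    then have "x = z \<and> y = x" by (intro eq) auto
    with lt[OF \<open>(x, y) \<in> M\<close>] show False by simp
  qed
  ultimately show "perfect {1..2 * n} M"
    using lt U unfolding Union_edges perfect_def by blast
next
  let ?h = "\<lambda>(a, b). {a, b :: nat}"
  assume P: "perfect {1..2 * n} M"
  have "\<Union>(?h ` M) = {1..2 * n}" using P unfolding Union_edges by (simp add: perfect_def)
  moreover have "disjoint (?h ` M)"
  proof (rule disjointI)
    fix A B assume "A \<in> ?h ` M" "B \<in> ?h ` M" "A \<noteq> B"
    then obtain a b c d where "(a, b) \<in> M" "(c, d) \<in> M" "A = {a, b}" "B = {c, d}" "(a, b) \<noteq> (c, d)"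
      by auto
    then show "A \<inter> B = {}"
      using perfect_fst_unique[OF P] perfect_snd_unique[OF P] perfect_fst_snd[OF P] by blast
  qed
  moreover have "card M = n" using perfect_card[OF P] by simp
  moreover have "\<forall>(a, b)\<in>M. a < b" using P by (simp add: perfect_def)
  ultimately show "M \<in> matchings n"
    by (auto simp: matchings_def partition_on_def)
qed

lemma finite_matchings: "finite (matchings n)"
proof (rule finite_subset)
  show "matchings n \<subseteq> Pow ({1..2 * n} \<times> {1..2 * n})"
    using perfect_subset matchings_iff_perfect by blast
qed auto

section \<open>Joining, splitting and relabelling matchings\<close>

lemma perfect_Un:
  assumes M: "perfect S M" and N: "perfect T N" and "S \<inter> T = {}"
  shows "perfect (S \<union> T) (M \<union> N)"
proof -
  note V = perfectD(6,7)[OF M] perfectD(6,7)[OF N] \<open>S \<inter> T = {}\<close>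
  have disj: "A \<inter> B = {}" if "A \<subseteq> S" "B \<subseteq> T" for A B
    using V(5) that by blast
  have "fst ` (M - N) \<inter> fst ` (N - M) = {}" "snd ` (M - N) \<inter> snd ` (N - M) = {}"
    using V by (auto intro!: disj)
  then have "inj_on fst (M \<union> N)" "inj_on snd (M \<union> N)"
    using perfectD(2,3)[OF M] perfectD(2,3)[OF N] by (simp_all add: inj_on_Un)
  moreover have "fst ` (M \<union> N) \<inter> snd ` (M \<union> N) = {}"
    unfolding image_Un Int_Un_distrib Int_Un_distrib2
    using perfectD(4)[OF M] perfectD(4)[OF N] disj[OF V(1,4)] disj[OF V(2,3)]
    by (simp add: Int_commute)
  moreover have "fst ` (M \<union> N) \<union> snd ` (M \<union> N) = S \<union> T"
    unfolding image_Un using perfectD(5)[OF M] perfectD(5)[OF N] by blast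
  moreover have "\<forall>(a, b)\<in>M \<union> N. a < b"
    unfolding ball_Un using perfectD(1)[OF M] perfectD(1)[OF N] by simp
  ultimately show ?thesis
    by (simp only: perfect_def)
qed

lemma perfect_Diff:
  assumes M: "perfect S M" and "N \<subseteq> M"
  shows "perfect (S - (fst ` N \<union> snd ` N)) (M - N)"
proof -
  note inj = perfectD(2,3)[OF M]
  have im: "fst ` (M - N) = fst ` M - fst ` N" "snd ` (M - N) = snd ` M - snd ` N"
    using inj_on_image_set_diff[OF inj(1)] inj_on_image_set_diff[OF inj(2)] \<open>N \<subseteq> M\<close> by auto
  have N: "fst ` N \<subseteq> fst ` M" "snd ` N \<subseteq> snd ` M"
    using \<open>N \<subseteq> M\<close> by auto
  have *: "A \<inter> B = {} \<Longrightarrow> A' \<subseteq> A \<Longrightarrow> B' \<subseteq> B \<Longrightarrow>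
      (A - A') \<union> (B - B') = (A \<union> B) - (A' \<union> B') \<and> (A - A') \<inter> (B - B') = {}" for A B A' B' :: "nat set"
    by blast
  have "fst ` (M - N) \<union> snd ` (M - N) = S - (fst ` N \<union> snd ` N)"
    "fst ` (M - N) \<inter> snd ` (M - N) = {}"
    unfolding im perfectD(5)[OF M, symmetric] using *[OF perfectD(4)[OF M] N] by simp_all
  moreover have "inj_on fst (M - N)" "inj_on snd (M - N)"
    using inj by (simp_all add: inj_on_diff)
  moreover have "\<forall>(a, b)\<in>M - N. a < b"
    using perfectD(1)[OF M] by simp
  ultimately show ?thesis
    by (simp only: perfect_def simp_thms)
qed

lemma perfect_singleton: "a < b \<Longrightarrow> perfect {a, b} {(a, b)}"
  by (auto simp: perfect_def)

lemma perfect_insert: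
  assumes "perfect S M" "a < b" "a \<notin> S" "b \<notin> S"
  shows "perfect (insert a (insert b S)) (insert (a, b) M)"
  using perfect_Un[OF perfect_singleton[OF assms(2)] assms(1)] assms by auto

lemma perfect_remove:
  assumes "perfect S M" "(a, b) \<in> M"
  shows "perfect (S - {a, b}) (M - {(a, b)})"
  using perfect_Diff[OF assms(1), of "{(a, b)}"] assms(2) by (simp add: insert_commute)

lemma perfect_relabel:
  assumes P: "perfect S M" and g: "strict_mono_on S g"
  shows "perfect (g ` S) (relabel g M)"
proof -
  note V = perfectD(6,7)[OF P]
  have inj: "inj_on g S" using g by (rule strict_mono_on_imp_inj_on)
  have im: "fst ` relabel g M = g ` fst ` M" "snd ` relabel g M = g ` snd ` M"
    by (simp_all add: relabel_def image_image)
  have "inj_on (fst \<circ> map_prod g g) M"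
    unfolding fst_comp_map_prod using perfectD(2)[OF P] inj_on_subset[OF inj V(1)]
    by (rule comp_inj_on)
  moreover have "inj_on (snd \<circ> map_prod g g) M"
    unfolding snd_comp_map_prod using perfectD(3)[OF P] inj_on_subset[OF inj V(2)]
    by (rule comp_inj_on)
  ultimately have "inj_on fst (relabel g M)" "inj_on snd (relabel g M)"
    unfolding relabel_def by (simp_all only: inj_on_imageI)
  moreover have "\<forall>(a, b)\<in>relabel g M. a < b"
    using strict_mono_onD[OF g] perfect_less[OF P] perfect_vertex[OF P] by (auto simp: relabel_def)
  moreover have "fst ` relabel g M \<inter> snd ` relabel g M = {}"
    unfolding im using inj_on_image_Int[OF inj V] perfectD(4)[OF P] by simp
  moreover have "fst ` relabel g M \<union> snd ` relabel g M = g ` S"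
    unfolding im image_Un[symmetric] perfectD(5)[OF P] ..
  ultimately show ?thesis by (simp only: perfect_def simp_thms)
qed

lemma relabel_simps:
  "relabel g (insert e M) = insert (map_prod g g e) (relabel g M)"
  "relabel g (M \<union> N) = relabel g M \<union> relabel g N"
  by (auto simp: relabel_def)

lemma relabel_id_on:
  assumes "\<And>a b. (a, b) \<in> M \<Longrightarrow> g a = a \<and> g b = b"
  shows "relabel g M = M"
proof -
  have "map_prod g g e = e" if "e \<in> M" for e using assms that by (cases e) simp
  then show ?thesis unfolding relabel_def by simp
qed

lemma relabel_relabel: "relabel f (relabel g M) = relabel (f \<circ> g) M"
  by (simp add: relabel_def image_comp map_prod.comp)

lemma relabel_inject:
  assumes "inj_on g S" "M \<subseteq> S \<times> S" "N \<subseteq> S \<times> S" "relabel g M = relabel g N"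
  shows "M = N"
  using assms inj_on_image_eq_iff[OF map_prod_inj_on[OF assms(1,1)]]
  by (auto simp: relabel_def)

section \<open>Nesting numbers under relabelling and disjoint union\<close>

lemma nested_relabel:
  assumes g: "strict_mono_on S g" and "e \<in> S \<times> S" "f \<in> S \<times> S"
  shows "nested (map_prod g g e) (map_prod g g f) \<longleftrightarrow> nested e f"
  using assms(2,3) by (auto simp: strict_mono_on_less[OF g])

lemma filter_image: "{y \<in> h ` X. P y} = h ` {x \<in> X. P (h x)}"
  by auto

lemma ne_alt: "ne M = card {p \<in> M \<times> M. nested (fst p) (snd p)}"
  unfolding ne_def by (rule arg_cong[of _ _ card]) auto

text \<open>Nesting depends only on the relative order of the endpoints. Monotonicity is asked only
  on a set containing the vertices, since \<open>close_gap p\<close> merges p with p - 1 and is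
  strictly monotone only away from p.\<close>

lemma ne_relabel:
  assumes g: "strict_mono_on S g" and M: "M \<subseteq> S \<times> S"
  shows "ne (relabel g M) = ne M"
proof -
  let ?G = "map_prod g g"
  let ?H = "map_prod ?G ?G"
  have inj: "inj_on ?G (S \<times> S)"
    using strict_mono_on_imp_inj_on[OF g] by (simp add: map_prod_inj_on)
  have prod: "?H ` (M \<times> M) = relabel g M \<times> relabel g M"
    unfolding relabel_def by (rule map_prod_surj_on) simp_all
  have "{p \<in> ?H ` (M \<times> M). nested (fst p) (snd p)}
      = ?H ` {p \<in> M \<times> M. nested (?G (fst p)) (?G (snd p))}"
    unfolding filter_image fst_map_prod snd_map_prod ..
  also have "{p \<in> M \<times> M. nested (?G (fst p)) (?G (snd p))} = {p \<in> M \<times> M. nested (fst p) (snd p)}"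
    by (intro Collect_cong conj_cong refl nested_relabel[OF g]) (use M in auto)
  finally have "ne (relabel g M) = card (?H ` {p \<in> M \<times> M. nested (fst p) (snd p)})"
    unfolding ne_alt prod by simp
  also have "\<dots> = ne M"
    unfolding ne_alt using M
    by (intro card_image inj_on_subset[OF map_prod_inj_on[OF inj inj]]) auto
  finally show ?thesis .
qed

lemma by_left_relabel:
  assumes "finite M" "inj_on fst M" "strict_mono_on S g" "M \<subseteq> S \<times> S"
  shows "by_left (relabel g M) = map (map_prod g g) (by_left M)"
proof -
  note p = by_left_props[OF assms(1,2)]
  have "sorted_wrt (<) (map fst (map (map_prod g g) (by_left M)))"
    using p(2) unfolding sorted_wrt_map
  proof (rule sorted_wrt_mono_rel[rotated])
    fix x y assume xy: "x \<in> set (by_left M)" "y \<in> set (by_left M)" "fst x < fst y"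
    then have "fst x \<in> S" "fst y \<in> S" using p(1) assms(4) by (auto simp: mem_Times_iff)
    then show "fst (map_prod g g x) < fst (map_prod g g y)"
      using strict_mono_onD[OF assms(3)] xy(3) by simp
  qed
  from by_left_unique[OF this] show ?thesis
    using p(1) by (simp add: relabel_def)
qed

lemma finite_nested_pairs: "finite X \<Longrightarrow> finite Y \<Longrightarrow> finite {(e, f). e \<in> X \<and> f \<in> Y \<and> nested e f}"
  by (rule finite_subset[of _ "X \<times> Y"]) auto

lemma not_nested_self: "\<not> nested e e"
  by (cases e) auto

lemma ne_Un:
  assumes "finite X" "finite Y" "X \<inter> Y = {}"
  shows "ne (X \<union> Y) = ne X + ne Y + card {(e, f). e \<in> X \<and> f \<in> Y \<and> nested e f}
    + card {(e, f). e \<in> Y \<and> f \<in> X \<and> nested e f}"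
proof -
  define P where "P A B = {(e, f). e \<in> A \<and> f \<in> B \<and> nested e f}" for A B
  have fin: "finite (P A B)" if "finite A" "finite B" for A B
    unfolding P_def using that by (rule finite_nested_pairs)
  have "P (X \<union> Y) (X \<union> Y) = ((P X X \<union> P Y Y) \<union> P X Y) \<union> P Y X"
    by (auto simp: P_def)
  also have "card \<dots> = card (P X X \<union> P Y Y \<union> P X Y) + card (P Y X)"
    using assms(3) by (intro card_Un_disjoint finite_UnI fin assms) (auto simp: P_def)
  also have "card (P X X \<union> P Y Y \<union> P X Y) = card (P X X \<union> P Y Y) + card (P X Y)"
    using assms(3) by (intro card_Un_disjoint finite_UnI fin assms) (auto simp: P_def)
  also have "card (P X X \<union> P Y Y) = card (P X X) + card (P Y Y)"
    using assms(3) by (intro card_Un_disjoint finite_UnI fin assms) (auto simp: P_def)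
  finally show ?thesis by (simp add: ne_def P_def)
qed

lemma ne_insert:
  assumes "finite X" "e \<notin> X"
  shows "ne (insert e X) = ne X + card {f \<in> X. nested e f} + card {f \<in> X. nested f e}"
proof -
  have "{(g, f). g \<in> X \<and> f \<in> {e} \<and> nested g f} = (\<lambda>f. (f, e)) ` {f \<in> X. nested f e}"
    "{(g, f). g \<in> {e} \<and> f \<in> X \<and> nested g f} = Pair e ` {f \<in> X. nested e f}"
    by auto
  then have "card {(g, f). g \<in> X \<and> f \<in> {e} \<and> nested g f} = card {f \<in> X. nested f e}"
    "card {(g, f). g \<in> {e} \<and> f \<in> X \<and> nested g f} = card {f \<in> X. nested e f}"
    by (simp_all add: card_image inj_on_def)
  moreover have "{(g, f). g \<in> {e} \<and> f \<in> {e} \<and> nested g f} = {}"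
    using not_nested_self by auto
  then have "ne {e} = 0" unfolding ne_def by (metis card.empty)
  ultimately show ?thesis
    using ne_Un[of X "{e}"] assms by simp
qed

subsection \<open>Matchings seen from their first edge\<close>

text \<open>Coordinates for a set of edges with distinct left endpoints: the set of left endpoints,
  and the right endpoints in the order of the left ones. In these coordinates the reconnections made
  by a step change the first argument only.\<close>

definition weld :: "nat set \<Rightarrow> nat list \<Rightarrow> edge set" where
  "weld L rs = set (zip (sorted_list_of_set L) rs)"

lemma weld_facts:
  assumes "finite L" "length rs = card L"
  shows "fst ` weld L rs = L" "snd ` weld L rs = set rs"
    "by_left (weld L rs) = zip (sorted_list_of_set L) rs"
    "inj_on fst (weld L rs)" "distinct rs \<Longrightarrow> inj_on snd (weld L rs)"
proof -
  have len: "length (sorted_list_of_set L) = length rs" using assms by simp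
  have map: "map fst (zip (sorted_list_of_set L) rs) = sorted_list_of_set L"
    "map snd (zip (sorted_list_of_set L) rs) = rs"
    using len by simp_all
  show "fst ` weld L rs = L"
    unfolding weld_def set_map[symmetric] map using assms(1) by simp
  show "snd ` weld L rs = set rs"
    unfolding weld_def set_map[symmetric] map ..
  show "by_left (weld L rs) = zip (sorted_list_of_set L) rs"
    unfolding weld_def by (rule by_left_unique) (simp add: map)
  show "inj_on fst (weld L rs)"
  proof -
    have "distinct (map fst (zip (sorted_list_of_set L) rs))" unfolding map by simp
    then show ?thesis unfolding weld_def distinct_map by simp
  qed
  show "inj_on snd (weld L rs)" if "distinct rs"
    using that unfolding weld_def by (metis distinct_map map(2))
qed

lemma finite_weld: "finite (weld L rs)"
  by (simp add: weld_def)

lemma weld_by_left: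
  assumes "finite F" "inj_on fst F"
  shows "F = weld (fst ` F) (map snd (by_left F))"
proof -
  note p = by_left_props[OF assms]
  have "set (map fst (by_left F)) = fst ` F" using p(1) by simp
  then have "sorted_list_of_set (fst ` F) = map fst (by_left F)"
    using p(2) by (metis List.finite_set sorted_list_of_set.idem_if_sorted_distinct strict_sorted_iff)
  then show ?thesis
    by (simp add: weld_def zip_map_fst_snd p(1))
qed

text \<open>
  A matching with first edge \<open>(1, \<rho>)\<close> is split into this edge, the edges \<open>weld L rs\<close> crossing it,
  and the set \<open>D\<close> of all others.
\<close>

definition layout :: "nat \<Rightarrow> edge set \<Rightarrow> nat set \<Rightarrow> nat list \<Rightarrow> bool" where
  "layout \<rho> D L rs \<longleftrightarrow> 1 < \<rho> \<and> finite D \<and> finite L \<and> length rs = card L \<and> distinct rs \<and>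
     (\<forall>l\<in>L. 1 < l \<and> l < \<rho>) \<and> (\<forall>x\<in>set rs. \<rho> < x) \<and>
     (\<forall>e\<in>D. 1 < fst e \<and> fst e < snd e \<and> (snd e < \<rho> \<or> \<rho> < fst e))"

definition arches :: "nat \<Rightarrow> edge set \<Rightarrow> nat set \<Rightarrow> nat list \<Rightarrow> edge set" where
  "arches \<rho> D L rs = insert (1, \<rho>) (D \<union> weld L rs)"

lemma layoutD:
  assumes "layout \<rho> D L rs"
  shows "1 < \<rho>" "finite D" "finite L" "length rs = card L" "distinct rs"
    "l \<in> L \<Longrightarrow> 1 < l \<and> l < \<rho>" "x \<in> set rs \<Longrightarrow> \<rho> < x"
    "e \<in> D \<Longrightarrow> 1 < fst e \<and> fst e < snd e \<and> (snd e < \<rho> \<or> \<rho> < fst e)"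
  using assms by (auto simp: layout_def)

lemma weld_mem:
  assumes "layout \<rho> D L rs" "e \<in> weld L rs"
  shows "fst e \<in> L" "snd e \<in> set rs" "1 < fst e" "fst e < \<rho>" "\<rho> < snd e"
proof -
  show "fst e \<in> L" "snd e \<in> set rs"
    using imageI[OF assms(2), of fst] imageI[OF assms(2), of snd]
      weld_facts(1,2)[OF layoutD(3,4)[OF assms(1)]] by simp_all
  then show "1 < fst e" "fst e < \<rho>" "\<rho> < snd e"
    using layoutD(6,7)[OF assms(1)] by simp_all
qed

lemma arches_parts:
  assumes "layout \<rho> D L rs"
  shows "{e \<in> arches \<rho> D L rs. crossed (1, \<rho>) e} = weld L rs"
    "arches \<rho> D L rs - weld L rs = insert (1, \<rho>) D"
    "arches \<rho> D L rs - weld L rs - {(1, \<rho>)} = D"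
    "arches \<rho> D L rs - {(1, \<rho>)} = D \<union> weld L rs"
proof -
  note D = layoutD(8)[OF assms] and W = weld_mem(3-5)[OF assms]
  have cr: "crossed (1, \<rho>) e \<longleftrightarrow> 1 < fst e \<and> fst e < \<rho> \<and> \<rho> < snd e \<or> fst e < 1 \<and> 1 < snd e \<and> snd e < \<rho>" for e
    by (cases e) simp
  have "crossed (1, \<rho>) e" if "e \<in> weld L rs" for e
    unfolding cr using W[OF that] by simp
  moreover have "\<not> crossed (1, \<rho>) e" if "e \<in> D" for e
    unfolding cr using D[OF that] by auto
  moreover have "\<not> crossed (1, \<rho>) (1, \<rho>)" by simp
  moreover have "(1, \<rho>) \<notin> D" "(1, \<rho>) \<notin> weld L rs"
    using D[of "(1, \<rho>)"] W[of "(1, \<rho>)"] by auto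
  ultimately show "{e \<in> arches \<rho> D L rs. crossed (1, \<rho>) e} = weld L rs"
    "arches \<rho> D L rs - weld L rs = insert (1, \<rho>) D"
    "arches \<rho> D L rs - weld L rs - {(1, \<rho>)} = D"
    "arches \<rho> D L rs - {(1, \<rho>)} = D \<union> weld L rs"
    unfolding arches_def by blast+
qed

text \<open>All three coordinates can be read off: the welded edges are those crossing the first
  edge, L is the set of their left endpoints, and rs lists their right endpoints in the order of the
  left ones.\<close>

lemma arches_inject:
  assumes "layout \<rho> D L rs" "layout \<rho> D' L' rs'" "arches \<rho> D L rs = arches \<rho> D' L' rs'"
  shows "D = D'" "L = L'" "rs = rs'"
proof -
  note p = arches_parts[OF assms(1)] and p' = arches_parts[OF assms(2)]
  note f = weld_facts[OF layoutD(3,4)[OF assms(1)]] and f' = weld_facts[OF layoutD(3,4)[OF assms(2)]]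
  have w: "weld L rs = weld L' rs'" using p(1) p'(1) assms(3) by simp
  then show "D = D'" using p(3) p'(3) assms(3) by simp
  show L: "L = L'" using w f(1) f'(1) by simp
  have "map snd (zip (sorted_list_of_set L) rs) = map snd (zip (sorted_list_of_set L') rs')"
    using w f(3) f'(3) by simp
  then show "rs = rs'"
    using layoutD(3,4)[OF assms(1)] layoutD(3,4)[OF assms(2)] by simp
qed

lemma perfect_weld:
  assumes "layout \<rho> D L rs"
  shows "perfect (L \<union> set rs) (weld L rs)"
proof -
  note f = weld_facts[OF layoutD(3,4)[OF assms]]
  have "\<forall>(a, b)\<in>weld L rs. a < b"
    using weld_mem(4,5)[OF assms] by fastforce
  moreover have "L \<inter> set rs = {}"
    using layoutD(6,7)[OF assms] by fastforce
  ultimately show ?thesis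
    using f layoutD(5)[OF assms] by (simp add: perfect_def)
qed

text \<open>The crossing edges are taken out and their right endpoints are welded to new left
  endpoints, so that only the vertices of L are vacated and only those of L' are occupied.\<close>

lemma perfect_arches_exchange:
  assumes P: "perfect S (arches \<rho> D L rs)" and l: "layout \<rho> D L rs" "layout \<rho> D L' rs"
    and "L' \<inter> (S - L) = {}"
  shows "perfect ((S - L) \<union> L') (arches \<rho> D L' rs)"
proof -
  note f = weld_facts[OF layoutD(3,4)[OF l(1)]]
  have "weld L rs \<subseteq> arches \<rho> D L rs" by (auto simp: arches_def)
  from perfect_Diff[OF P this] have 1: "perfect (S - (L \<union> set rs)) (insert (1, \<rho>) D)"
    unfolding arches_parts(2)[OF l(1)] f(1,2) .
  have "snd ` weld L rs \<subseteq> S"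
    using perfectD(7)[OF P] by (auto simp: arches_def)
  then have rs: "set rs \<subseteq> S" unfolding f(2) .
  have "L \<inter> set rs = {}"
    using layoutD(6,7)[OF l(1)] by fastforce
  moreover have "(S - (L \<union> set rs)) \<inter> (L' \<union> set rs) = {}" using assms(4) by blast
  from perfect_Un[OF 1 perfect_weld[OF l(2)] this]
  have "perfect (S - (L \<union> set rs) \<union> (L' \<union> set rs)) (arches \<rho> D L' rs)"
    by (simp add: arches_def)
  moreover have "S - (L \<union> set rs) \<union> (L' \<union> set rs) = (S - L) \<union> L'"
    using rs calculation(1) by blast
  ultimately show ?thesis by simp
qed

lemma arches_exist:
  assumes P: "perfect S N" and S: "finite S" "\<And>x. x \<in> S \<Longrightarrow> 1 \<le> x" and r: "(1, r) \<in> N"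
  obtains D L rs where "layout r D L rs" "N = arches r D L rs"
proof -
  define F where "F = {e \<in> N. 1 < fst e \<and> fst e < r \<and> r < snd e}"
  have "finite N" using perfect_finite[OF P S(1)] .
  then have F: "finite F" "F \<subseteq> N" by (auto simp: F_def)
  have inj: "inj_on fst F" "inj_on snd F"
    using perfect_inj[OF P] F(2) by (auto intro: inj_on_subset)
  note p = by_left_props[OF F(1) inj(1)]
  define D where "D = N - {(1, r)} - F"
  define rs where "rs = map snd (by_left F)"
  have w: "F = weld (fst ` F) rs" unfolding rs_def by (rule weld_by_left[OF F(1) inj(1)])
  have "distinct (by_left F)" using p(2) by (auto simp: strict_sorted_iff distinct_map)
  then have "distinct rs" using inj(2) by (simp add: rs_def distinct_map p(1))
  moreover have "length rs = card (fst ` F)"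
    by (simp add: rs_def p(3) card_image[OF inj(1)])
  \<comment> \<open>No edge other than (1, r) touches 1 or r, so an edge that does not pass over r
    lies entirely on one side of it.\<close>
  moreover have "1 < fst e \<and> fst e < snd e \<and> (snd e < r \<or> r < fst e)" if "e \<in> D" for e
  proof -
    obtain a b where e: "e = (a, b)" by (cases e)
    then have ab: "(a, b) \<in> N" "(a, b) \<noteq> (1, r)" "(a, b) \<notin> F" using that by (auto simp: D_def)
    have "1 \<le> a" "a < b" using S(2) perfect_vertex[OF P ab(1)] perfect_less[OF P ab(1)] by auto
    moreover have "a \<noteq> 1" using perfect_fst_unique[OF P r, of b] ab(1,2) by auto
    moreover have "a \<noteq> r" using perfect_fst_snd[OF P _ r] ab(1) by auto
    moreover have "b \<noteq> r" using perfect_snd_unique[OF P ab(1), of 1] r \<open>a \<noteq> 1\<close> by auto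
    moreover have "\<not> (1 < a \<and> a < r \<and> r < b)" using ab(1,3) by (simp add: F_def)
    ultimately show ?thesis unfolding e by auto
  qed
  moreover have "1 < r" using perfect_less[OF P r] .
  moreover have "set rs = snd ` F" by (simp add: rs_def p(1))
  ultimately have "layout r D (fst ` F) rs"
    using \<open>finite N\<close> F(1) unfolding layout_def D_def by (auto simp: F_def)
  moreover have "N = arches r D (fst ` F) rs"
    unfolding arches_def w[symmetric] D_def using r F(2) by auto
  ultimately show thesis by (rule that)
qed

subsection \<open>Counting nestings\<close>

lemma ne_set:
  assumes "distinct es"
  shows "ne (set es) = card {(i, j). i < length es \<and> j < length es \<and> nested (es ! i) (es ! j)}"
proof -
  let ?h = "map_prod ((!) es) ((!) es)"
  let ?I = "{p \<in> {..<length es} \<times> {..<length es}. nested (es ! fst p) (es ! snd p)}"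
  have bij: "bij_betw ((!) es) {..<length es} (set es)"
    using assms by (intro bij_betw_nth) auto
  have "?h ` ({..<length es} \<times> {..<length es}) = set es \<times> set es"
    using bij by (intro map_prod_surj_on) (auto simp: bij_betw_def)
  then have "{p \<in> set es \<times> set es. nested (fst p) (snd p)} = ?h ` ?I"
    using filter_image[of ?h "{..<length es} \<times> {..<length es}" "\<lambda>p. nested (fst p) (snd p)"]
    unfolding fst_map_prod snd_map_prod by simp
  moreover have "inj_on ?h ?I"
    using bij by (intro inj_on_subset[OF map_prod_inj_on]) (auto simp: bij_betw_def)
  moreover have "?I = {(i, j). i < length es \<and> j < length es \<and> nested (es ! i) (es ! j)}"
    by auto
  ultimately show ?thesis
    unfolding ne_alt by (simp add: card_image)
qed

definition inversions :: "nat list \<Rightarrow> nat" where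
  "inversions rs = card {(i, j). i < j \<and> j < length rs \<and> rs ! j < rs ! i}"

text \<open>All left endpoints lie below \<rho> and all right endpoints above it, so two welded
  edges are either crossed or nested, and they are nested exactly when their right endpoints are in
  the opposite order to their left endpoints. Hence the count does not depend on L.\<close>

lemma ne_weld:
  assumes "layout \<rho> D L rs"
  shows "ne (weld L rs) = inversions rs"
proof -
  let ?es = "zip (sorted_list_of_set L) rs"
  have len: "length (sorted_list_of_set L) = length rs" using layoutD(3,4)[OF assms] by simp
  have srt: "sorted_wrt (<) (sorted_list_of_set L)" by simp
  have lt: "sorted_list_of_set L ! i < sorted_list_of_set L ! j \<longleftrightarrow> i < j"
    if "i < length rs" "j < length rs" for i j
    using sorted_wrt_nth_less[OF srt, of i j] sorted_wrt_nth_less[OF srt, of j i] that len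
    by (cases i j rule: linorder_cases) auto
  have sep: "sorted_list_of_set L ! i < rs ! j" if "i < length rs" "j < length rs" for i j
  proof -
    have "sorted_list_of_set L ! i \<in> L" "rs ! j \<in> set rs"
      using that len layoutD(3)[OF assms] nth_mem[of i "sorted_list_of_set L"] by auto
    then show ?thesis using layoutD(6,7)[OF assms] by fastforce
  qed
  have "{(i, j). i < length ?es \<and> j < length ?es \<and> nested (?es ! i) (?es ! j)}
      = {(i, j). i < j \<and> j < length rs \<and> rs ! j < rs ! i}"
    using len lt sep by auto
  moreover have "distinct ?es" using layoutD(5)[OF assms] by (simp add: distinct_zipI2)
  ultimately show ?thesis
    unfolding weld_def inversions_def by (simp add: ne_set)
qed

lemma card_pairs:
  assumes "finite X" "finite Y"
  shows "card {(e, f). e \<in> X \<and> f \<in> Y \<and> P e f} = (\<Sum>e\<in>X. card {f \<in> Y. P e f})"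
proof -
  have "{(e, f). e \<in> X \<and> f \<in> Y \<and> P e f} = Sigma X (\<lambda>e. {f \<in> Y. P e f})" by auto
  then show ?thesis using assms by simp
qed

text \<open>An edge of D lies on one side of \<rho> and cannot contain a welded edge. A welded edge
  (l, x) contains an edge of D either below \<rho>, which is a condition on l alone, or above
  \<rho>, which is a condition on x alone. So the mixed nestings split into a sum over L and a sum
  over rs that never refer to the pairing of left and right endpoints.\<close>

lemma ne_arches:
  assumes l: "layout \<rho> D L rs"
  shows "ne (D \<union> weld L rs) = ne D + inversions rs + (\<Sum>l\<in>L. card {e \<in> D. l < fst e \<and> snd e < \<rho>})
      + (\<Sum>x\<in>set rs. card {e \<in> D. \<rho> < fst e \<and> snd e < x})"
    "ne (arches \<rho> D L rs) = ne (D \<union> weld L rs) + card {e \<in> D. snd e < \<rho>}"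
proof -
  note D = layoutD(8)[OF l] and W = weld_mem[OF l] and fin = layoutD(2)[OF l] finite_weld
  note f = weld_facts[OF layoutD(3,4)[OF l]]
  have nst: "nested e g \<longleftrightarrow> fst e < fst g \<and> fst g < snd g \<and> snd g < snd e" for e g
    by (cases e; cases g) simp
  have disj: "D \<inter> weld L rs = {}" using D W by fastforce
  have 1: "{(e, g). e \<in> D \<and> g \<in> weld L rs \<and> nested e g} = {}"
    using D W unfolding nst by fastforce
  have "card {(e, g). e \<in> weld L rs \<and> g \<in> D \<and> nested e g}
      = (\<Sum>e\<in>weld L rs. card {g \<in> D. nested e g})"
    using fin by (intro card_pairs)
  also have "\<dots> = (\<Sum>e\<in>weld L rs. card {g \<in> D. fst e < fst g \<and> snd g < \<rho>}
      + card {g \<in> D. \<rho> < fst g \<and> snd g < snd e})"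
  proof (rule sum.cong[OF refl])
    fix e assume e: "e \<in> weld L rs"
    have "{g \<in> D. nested e g} = {g \<in> D. fst e < fst g \<and> snd g < \<rho>} \<union> {g \<in> D. \<rho> < fst g \<and> snd g < snd e}"
      using D W[OF e] unfolding nst by fastforce
    moreover have "{g \<in> D. fst e < fst g \<and> snd g < \<rho>} \<inter> {g \<in> D. \<rho> < fst g \<and> snd g < snd e} = {}"
      using D by fastforce
    ultimately show "card {g \<in> D. nested e g} = card {g \<in> D. fst e < fst g \<and> snd g < \<rho>}
      + card {g \<in> D. \<rho> < fst g \<and> snd g < snd e}"
      using fin(1) by (simp add: card_Un_disjoint)
  qed
  also have "\<dots> = (\<Sum>l\<in>fst ` weld L rs. card {e \<in> D. l < fst e \<and> snd e < \<rho>})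
      + (\<Sum>x\<in>snd ` weld L rs. card {e \<in> D. \<rho> < fst e \<and> snd e < x})"
    by (simp add: sum.distrib sum.reindex f(4) f(5)[OF layoutD(5)[OF l]])
  finally have 2: "card {(e, g). e \<in> weld L rs \<and> g \<in> D \<and> nested e g}
      = (\<Sum>l\<in>L. card {e \<in> D. l < fst e \<and> snd e < \<rho>})
      + (\<Sum>x\<in>set rs. card {e \<in> D. \<rho> < fst e \<and> snd e < x})"
    unfolding f(1,2) .
  show "ne (D \<union> weld L rs) = ne D + inversions rs + (\<Sum>l\<in>L. card {e \<in> D. l < fst e \<and> snd e < \<rho>})
      + (\<Sum>x\<in>set rs. card {e \<in> D. \<rho> < fst e \<and> snd e < x})"
    unfolding ne_Un[OF fin(1) finite_weld disj] 1 2 ne_weld[OF l] by simp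
  have "(1, \<rho>) \<notin> D \<union> weld L rs"
    using D[of "(1, \<rho>)"] W(3)[of "(1, \<rho>)"] by auto
  moreover have "{e \<in> D \<union> weld L rs. nested e (1, \<rho>)} = {}"
    using D W unfolding nst by fastforce
  moreover have "{e \<in> D \<union> weld L rs. nested (1, \<rho>) e} = {e \<in> D. snd e < \<rho>}"
    using D W unfolding nst by fastforce
  ultimately show "ne (arches \<rho> D L rs) = ne (D \<union> weld L rs) + card {e \<in> D. snd e < \<rho>}"
    unfolding arches_def using ne_insert[of "D \<union> weld L rs" "(1, \<rho>)"] fin by simp
qed

subsection \<open>The two modification steps\<close>

text \<open>
  Matchings before and after a step are compared in the labels in which the vertex \<open>r\<close> is the new
  one, the vertex 2 has not yet been deleted, and the first edge is therefore \<open>(1, Suc r)\<close>.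
\<close>

lemma relabel_set_zip: "relabel g (set (zip xs ys)) = set (zip (map g xs) (map g ys))"
  unfolding zip_map_map relabel_def set_map map_prod_def ..

lemma map_open_gap_less: "(\<And>x. x \<in> set xs \<Longrightarrow> x < p) \<Longrightarrow> map (open_gap p) xs = xs"
  by (rule map_idI) (simp add: open_gap_def)

lemma map_open_gap_ge: "(\<And>x. x \<in> set xs \<Longrightarrow> p \<le> x) \<Longrightarrow> map (open_gap p) xs = map Suc xs"
  by (rule map_cong[OF refl]) (simp add: open_gap_def not_less)

lemma strict_mono_open_gap: "strict_mono (open_gap p)"
  by (rule strict_monoI) (simp add: open_gap_def)

text \<open>The left endpoints in L are below r and the right endpoints in rs above it, so freeing
  the position r shifts only the latter.\<close>

lemma relabel_layout:
  assumes "layout r D L rs"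
  shows "layout (Suc r) (relabel (open_gap r) D) L (map Suc rs)"
    "relabel (open_gap r) (arches r D L rs) = arches (Suc r) (relabel (open_gap r) D) L (map Suc rs)"
proof -
  note l = layoutD[OF assms]
  have "1 < fst e \<and> fst e < snd e \<and> (snd e < Suc r \<or> Suc r < fst e)"
    if e: "e \<in> relabel (open_gap r) D" for e
  proof -
    obtain f where f: "e = map_prod (open_gap r) (open_gap r) f" "f \<in> D"
      using e unfolding relabel_def by (rule imageE)
    show ?thesis using l(8)[OF f(2)] unfolding f(1) fst_map_prod snd_map_prod open_gap_def by auto
  qed
  then show "layout (Suc r) (relabel (open_gap r) D) L (map Suc rs)"
    using l unfolding layout_def by (auto simp: relabel_def distinct_map less_SucI)
  have "map (open_gap r) (sorted_list_of_set L) = sorted_list_of_set L"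
    by (rule map_open_gap_less) (use l(3,6) in auto)
  moreover have "map (open_gap r) rs = map Suc rs"
    by (rule map_open_gap_ge) (use l(7) in fastforce)
  ultimately have "relabel (open_gap r) (weld L rs) = weld L (map Suc rs)"
    unfolding weld_def relabel_set_zip by (simp only:)
  then show "relabel (open_gap r) (arches r D L rs) = arches (Suc r) (relabel (open_gap r) D) L (map Suc rs)"
    unfolding arches_def relabel_simps using l(1) by (simp add: open_gap_def)
qed

lemma sorted_list_of_set_eqI:
  assumes "sorted_wrt (<) xs" "set xs = A"
  shows "sorted_list_of_set A = xs"
  using assms by (metis sorted_list_of_set.idem_if_sorted_distinct strict_sorted_iff)

text \<open>Turns the index in \<open>nest_step\<close> into a description of v by the number of
  elements below it. Both the nesting count and the recovery of q use v in this form.\<close>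

lemma sorted_list_of_set_remove_nth:
  assumes "finite V" "s < card V"
  defines "vs \<equiv> sorted_list_of_set V"
  shows "vs ! s \<in> V" "card {x \<in> V. x < vs ! s} = s"
    "sorted_list_of_set (V - {vs ! s}) = take s vs @ drop (Suc s) vs"
proof -
  have len: "s < length vs" and V: "set vs = V" and srt: "sorted_wrt (<) vs"
    using assms by (simp_all add: vs_def)
  define xs v ys where "xs = take s vs" "v = vs ! s" "ys = drop (Suc s) vs"
  have vs: "vs = xs @ v # ys" using id_take_nth_drop[OF len] by (simp add: xs_v_ys_def)
  have srt': "sorted_wrt (<) (xs @ v # ys)" using srt unfolding vs .
  have V': "V = set xs \<union> insert v (set ys)" using V unfolding vs by simp
  show "vs ! s \<in> V" using len V nth_mem by blast
  have "{x \<in> V. x < v} = set xs"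
    using srt' unfolding V' sorted_wrt_append by auto
  moreover have "distinct xs" using srt' by (auto simp: sorted_wrt_append strict_sorted_iff)
  ultimately show "card {x \<in> V. x < vs ! s} = s"
    using len by (simp add: xs_v_ys_def distinct_card)
  have "sorted_wrt (<) (xs @ ys)" using srt' by (auto simp: sorted_wrt_append)
  moreover have "set (xs @ ys) = V - {v}" using srt' unfolding V' sorted_wrt_append by auto
  ultimately have "sorted_list_of_set (V - {v}) = xs @ ys" by (rule sorted_list_of_set_eqI)
  then show "sorted_list_of_set (V - {vs ! s}) = take s vs @ drop (Suc s) vs"
    by (simp add: xs_v_ys_def)
qed

text \<open>The vertex 2 is the least element of L and the new vertex r exceeds all of L. Dropping
  the head of the sorted list and appending r shifts every right endpoint to the next left endpoint,
  which is the prescribed reconnection.\<close>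

lemma cross_step_arches:
  assumes lay: "layout r D L rs" and "2 \<in> L"
  shows "cross_step r (arches r D L rs) = relabel (close_gap 2)
    (arches (Suc r) (relabel (open_gap r) D) (insert r (L - {2})) (map Suc rs))"
proof -
  note l = layoutD[OF lay]
  have f: "by_left (weld L rs) = zip (sorted_list_of_set L) rs" using weld_facts(3)[OF l(3,4)] .
  have len: "length (sorted_list_of_set L) = length rs" using l(3,4) by simp
  define ls where "ls = sorted_list_of_set (L - {2})"
  have "Min L = 2" using \<open>2 \<in> L\<close> l(3,6) by (intro Min_eqI) fastforce+
  then have L: "sorted_list_of_set L = 2 # ls"
    using sorted_list_of_set_nonempty[of L] \<open>2 \<in> L\<close> l(3) unfolding ls_def by auto
  have ls: "set ls = L - {2}" "sorted_wrt (<) ls" using l(3) by (simp_all add: ls_def)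
  have L': "sorted_list_of_set (insert r (L - {2})) = ls @ [r]"
    by (rule sorted_list_of_set_eqI) (use ls l(6) in \<open>auto simp: sorted_wrt_append\<close>)
  have "rs \<noteq> []" using L len by auto
  then have rs: "rs = butlast rs @ [last rs]" by simp
  have "map (open_gap r) ls = ls"
    by (rule map_open_gap_less) (use ls l(6) in auto)
  moreover have "map (open_gap r) (butlast rs) = map Suc (butlast rs)"
    by (rule map_open_gap_ge) (use l(7) in \<open>auto dest!: in_set_butlastD intro: less_imp_le\<close>)
  ultimately have z: "relabel (open_gap r) (set (zip ls (butlast rs))) = set (zip ls (map Suc (butlast rs)))"
    unfolding relabel_set_zip by (simp only:)
  have og: "open_gap r (last rs) = Suc (last rs)" "open_gap r 1 = 1" "open_gap r r = Suc r"
    using l(1) l(7)[of "last rs"] \<open>rs \<noteq> []\<close> by (auto simp: open_gap_def)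
  have "zip (ls @ [r]) (map Suc rs) = zip ls (map Suc (butlast rs)) @ [(r, Suc (last rs))]"
  proof -
    have "map Suc rs = map Suc (butlast rs) @ [Suc (last rs)]" by (subst rs) simp
    then show ?thesis using len L by simp
  qed
  then have w: "weld (insert r (L - {2})) (map Suc rs)
      = insert (r, Suc (last rs)) (set (zip ls (map Suc (butlast rs))))"
    unfolding weld_def L' by simp
  have "map fst (zip (2 # ls) rs) = 2 # ls" "map snd (zip (2 # ls) rs) = rs" using len L by simp_all
  then have "cross_step r (arches r D L rs) = relabel (close_gap 2) (insert (r, open_gap r (last rs))
    (relabel (open_gap r) (insert (1, r) D \<union> set (zip ls (butlast rs)))))"
    unfolding cross_step_def Let_def arches_parts(1,2)[OF lay] f L by simp
  also have "insert (r, open_gap r (last rs))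
      (relabel (open_gap r) (insert (1, r) D \<union> set (zip ls (butlast rs))))
    = arches (Suc r) (relabel (open_gap r) D) (insert r (L - {2})) (map Suc rs)"
    unfolding relabel_simps z arches_def w map_prod_simp og by auto
  finally show ?thesis .
qed

text \<open>The reconnection welds the unchanged list of right endpoints to V without v. What
  remains is to see that the number s of edges crossing (1, r) but not (2, q) is the number of
  elements of V above q.\<close>

lemma nest_step_arches:
  assumes lay: "layout r (insert (2, q) D) L rs" and D: "(2, q) \<notin> D"
    and q: "2 < q" "q < r" "q \<notin> L" "2 \<notin> L"
  obtains v where "v \<in> insert q L" "card {x \<in> insert q L. x < v} = card {x \<in> insert q L. q < x}"
    "nest_step r q (arches r (insert (2, q) D) L rs) = relabel (close_gap 2)
      (arches (Suc r) (insert (v, r) (relabel (open_gap r) D)) (insert q L - {v}) (map Suc rs))"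
proof -
  note l = layoutD[OF lay]
  note f = weld_facts[OF l(3,4)]
  let ?W = "weld L rs"
  have len: "length (sorted_list_of_set L) = length rs" using l(3,4) by simp
  define V where "V = insert q L"
  define s where "s = card {x \<in> V. q < x}"
  define vs where "vs = sorted_list_of_set V"
  have V: "finite V" using l(3) by (simp add: V_def)
  \<comment> \<open>The element q is not above itself, so s is a valid index into the list of
    V.\<close>
  have "{x \<in> V. q < x} \<subset> V" by (auto simp: V_def)
  then have "s < card V" unfolding s_def using V by (rule psubset_card_mono[rotated])
  note v = sorted_list_of_set_remove_nth[OF V this, folded vs_def]
  \<comment> \<open>A welded edge starts beyond 2, not at q, and ends beyond r > q, so it crosses
    (2, q) exactly when it starts before q.\<close>
  have "{e \<in> ?W. \<not> crossed (2, q) e} = {e \<in> ?W. q < fst e}"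
  proof (intro Collect_cong conj_cong refl)
    fix e assume e: "e \<in> ?W"
    obtain a b where ab: "e = (a, b)" by (cases e)
    have "a \<noteq> 2" "a \<noteq> q" using weld_mem(1)[OF lay e] q(3,4) unfolding ab by auto
    then show "(\<not> crossed (2, q) e) = (q < fst e)"
      using weld_mem[OF lay e] q(1,2) unfolding ab by auto
  qed
  moreover have "inj_on fst {e \<in> ?W. q < fst e}" using f(4) by (rule inj_on_subset) auto
  then have "card {e \<in> ?W. q < fst e} = card (fst ` {e \<in> ?W. q < fst e})"
    by (simp add: card_image)
  moreover have "fst ` {e \<in> ?W. q < fst e} = {x \<in> fst ` ?W. q < x}" by auto
  moreover have "{x \<in> fst ` ?W. q < x} = {x \<in> V. q < x}" by (auto simp: V_def f(1))
  ultimately have s: "card {e \<in> ?W. \<not> crossed (2, q) e} = s" by (simp add: s_def)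
  have rs: "map snd (by_left ?W) = rs" unfolding f(3) using len by simp
  have minus: "arches r (insert (2, q) D) L rs - insert (2, q) ?W = insert (1, r) D"
    using arches_parts(2)[OF lay] D by auto
  have Vr: "x < r" if "x \<in> V" for x using that q(2) l(6) by (auto simp: V_def)
  have "map (open_gap r) (take s vs @ drop (Suc s) vs) = take s vs @ drop (Suc s) vs"
    by (rule map_open_gap_less) (use V in \<open>auto simp: vs_def dest!: in_set_takeD in_set_dropD intro: Vr\<close>)
  moreover have "map (open_gap r) rs = map Suc rs"
    by (rule map_open_gap_ge) (use l(7) in fastforce)
  ultimately have z: "relabel (open_gap r) (set (zip (take s vs @ drop (Suc s) vs) rs))
      = weld (V - {vs ! s}) (map Suc rs)"
    unfolding relabel_set_zip weld_def v(3) by (simp only:)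
  have og: "open_gap r (vs ! s) = vs ! s" "open_gap r 1 = 1" "open_gap r r = Suc r"
    using l(1) Vr[OF v(1)] by (auto simp: open_gap_def)
  have "nest_step r q (arches r (insert (2, q) D) L rs) = relabel (close_gap 2)
    (insert (open_gap r (vs ! s), r) (relabel (open_gap r)
      (insert (1, r) D \<union> set (zip (take s vs @ drop (Suc s) vs) rs))))"
    unfolding nest_step_def Let_def arches_parts(1)[OF lay] s rs minus f(1) V_def[symmetric]
      vs_def[symmetric] ..
  also have "insert (open_gap r (vs ! s), r) (relabel (open_gap r)
      (insert (1, r) D \<union> set (zip (take s vs @ drop (Suc s) vs) rs)))
    = arches (Suc r) (insert (vs ! s, r) (relabel (open_gap r) D)) (V - {vs ! s}) (map Suc rs)"
    unfolding relabel_simps z arches_def map_prod_simp og by auto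
  finally show thesis
    using that[of "vs ! s"] v(1,2) unfolding V_def s_def by blast
qed

section \<open>The gap maps, and the steps applied to matchings\<close>

lemma close_open_gap: "close_gap p (open_gap p v) = v"
  by (simp add: open_gap_def close_gap_def)

lemma open_close_gap: "v \<noteq> p \<Longrightarrow> open_gap p (close_gap p v) = v"
  by (auto simp: open_gap_def close_gap_def)

lemma strict_mono_close_gap: "strict_mono_on (- {p}) (close_gap p)"
  by (rule strict_mono_onI) (auto simp: close_gap_def)

lemma open_gap_image:
  assumes "a \<le> p" "p \<le> Suc k"
  shows "open_gap p ` {a..k} = {a..Suc k} - {p}"
proof (intro equalityI subsetI)
  fix v assume "v \<in> open_gap p ` {a..k}"
  then show "v \<in> {a..Suc k} - {p}" using assms by (auto simp: open_gap_def)
next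
  fix v assume v: "v \<in> {a..Suc k} - {p}"
  then have "close_gap p v \<in> {a..k}" using assms by (auto simp: close_gap_def)
  moreover have "v = open_gap p (close_gap p v)" using v by (simp add: open_close_gap)
  ultimately show "v \<in> open_gap p ` {a..k}" by (rule rev_image_eqI)
qed

lemma close_gap_image:
  assumes "a \<le> p" "p \<le> Suc k"
  shows "close_gap p ` ({a..Suc k} - {p}) = {a..k}"
  unfolding open_gap_image[OF assms, symmetric] image_image close_open_gap by simp

lemma inj_open_gap: "inj (open_gap p)"
  using strict_mono_open_gap by (rule strict_mono_imp_inj_on)

lemma relabel_open_gap_inject: "relabel (open_gap p) M = relabel (open_gap p) N \<Longrightarrow> M = N"
  using relabel_inject[of "open_gap p" UNIV M N] inj_open_gap by auto

lemma relabel_Diff_singleton: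
  assumes "inj g"
  shows "relabel g (M - {e}) = relabel g M - {map_prod g g e}"
  unfolding relabel_def using image_set_diff[OF prod.inj_map[OF assms assms], of M "{e}"] by simp

lemma perfect_relabel_open_gap:
  assumes "perfect {1..2 * m} N" "(1, r) \<in> N"
  shows "perfect ({1..Suc (2 * m)} - {r}) (relabel (open_gap r) N)"
proof -
  have "r \<in> {1..2 * m}" using perfect_vertex[OF assms] by simp
  then have "open_gap r ` {1..2 * m} = {1..Suc (2 * m)} - {r}"
    by (intro open_gap_image) auto
  then show ?thesis
    using perfect_relabel[OF assms(1), of "open_gap r"] strict_mono_open_gap[of r]
    by (metis monotone_on_subset subset_UNIV)
qed

lemma arches_insert: "arches \<rho> (insert e D) L rs = insert e (arches \<rho> D L rs)"
  by (auto simp: arches_def)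

lemma cross_step_arches_exist:
  assumes P: "perfect {1..2 * m} N" and r: "(1, r) \<in> N" and x: "(2, x) \<in> N" "r < x"
  obtains D L rs where "layout r D L rs" "N = arches r D L rs" "2 \<in> L" "r \<notin> L"
    "layout (Suc r) (relabel (open_gap r) D) (insert r (L - {2})) (map Suc rs)"
    "perfect ({1..Suc (2 * m)} - {2})
      (arches (Suc r) (relabel (open_gap r) D) (insert r (L - {2})) (map Suc rs))"
    "cross_step r N = relabel (close_gap 2)
      (arches (Suc r) (relabel (open_gap r) D) (insert r (L - {2})) (map Suc rs))"
proof -
  obtain D L rs where lay: "layout r D L rs" and N: "N = arches r D L rs"
    using arches_exist[OF P _ _ r] by auto
  note l = layoutD[OF lay]
  let ?D = "relabel (open_gap r) D" and ?rs = "map Suc rs" and ?L = "insert r (L - {2})"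
  note opened = relabel_layout[OF lay]
  \<comment> \<open>The vertex 2 is a left endpoint, r is a right endpoint.\<close>
  have "r \<noteq> 2" using perfect_fst_snd[OF P x(1)] r by auto
  then have r2: "2 < r" using perfect_less[OF P r] by simp
  then have "crossed (1, r) (2, x)" using x(2) by simp
  then have "(2, x) \<in> weld L rs"
    unfolding arches_parts(1)[OF lay, symmetric] N[symmetric] using x(1) by simp
  then have L2: "2 \<in> L" using weld_mem(1)[OF lay, of "(2, x)"] by simp
  have rL: "r \<notin> L" using l(6) by auto
  have "card ?L = card L" using L2 rL l(3) by (metis DiffD1 card.insert card.remove finite_Diff)
  moreover have "1 < a \<and> a < Suc r" if "a \<in> ?L" for a
    using that r2 l(6)[of a] by auto
  ultimately have lay': "layout (Suc r) ?D ?L ?rs"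
    using opened(1) unfolding layout_def by simp
  have P': "perfect ({1..Suc (2 * m)} - {r}) (arches (Suc r) ?D L ?rs)"
    using perfect_relabel_open_gap[OF P r] unfolding N opened(2) .
  have m: "r \<in> {1..2 * m}" "2 \<in> {1..2 * m}" using perfect_vertex[OF P] r x by blast+
  have "fst ` weld L ?rs \<subseteq> {1..Suc (2 * m)} - {r}"
    using perfectD(6)[OF P'] unfolding arches_def by auto
  then have LS: "L \<subseteq> {1..Suc (2 * m)} - {r}"
    unfolding weld_facts(1)[OF layoutD(3,4)[OF opened(1)]] .
  \<comment> \<open>Before the exchange the unoccupied vertex is r, afterwards it is 2, ready to be
    closed.\<close>
  have "({1..Suc (2 * m)} - {r} - L) \<union> ?L = {1..Suc (2 * m)} - {2}"
    using m LS r2 L2 by fastforce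
  moreover have "?L \<inter> ({1..Suc (2 * m)} - {r} - L) = {}" by blast
  ultimately have "perfect ({1..Suc (2 * m)} - {2}) (arches (Suc r) ?D ?L ?rs)"
    using perfect_arches_exchange[OF P' opened(1) lay'] by simp
  then show thesis
    using that[OF lay N L2 rL lay'] cross_step_arches[OF lay L2] unfolding N by simp
qed

lemma nest_step_arches_exist:
  assumes P: "perfect {1..2 * m} N" and r: "(1, r) \<in> N" and q: "(2, q) \<in> N" "q < r"
  obtains D L rs v where "layout r (insert (2, q) D) L rs" "(2, q) \<notin> D"
    "N = arches r (insert (2, q) D) L rs" "2 < q" "q \<notin> L" "2 \<notin> L"
    "v \<in> insert q L" "card {x \<in> insert q L. x < v} = card {x \<in> insert q L. q < x}"
    "layout (Suc r) (insert (v, r) (relabel (open_gap r) D)) (insert q L - {v}) (map Suc rs)"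
    "perfect ({1..Suc (2 * m)} - {2})
      (arches (Suc r) (insert (v, r) (relabel (open_gap r) D)) (insert q L - {v}) (map Suc rs))"
    "nest_step r q N = relabel (close_gap 2)
      (arches (Suc r) (insert (v, r) (relabel (open_gap r) D)) (insert q L - {v}) (map Suc rs))"
proof -
  obtain D0 L rs where lay0: "layout r D0 L rs" and N0: "N = arches r D0 L rs"
    using arches_exist[OF P _ _ r] by auto
  have q2: "2 < q" using perfect_less[OF P q(1)] .
  have "\<not> crossed (1, r) (2, q)" using q(2) by simp
  then have "(2, q) \<notin> weld L rs" using arches_parts(1)[OF lay0] by blast
  then have "(2, q) \<in> D0" using q(1) unfolding N0 arches_def by simp
  \<comment> \<open>The edge (2, q) does not cross (1, r), hence belongs to the part outside the
    weld. It is split off because the step replaces it as well.\<close>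
  define D where "D = D0 - {(2, q)}"
  have D0: "D0 = insert (2, q) D" and Dq: "(2, q) \<notin> D" using \<open>(2, q) \<in> D0\<close> by (auto simp: D_def)
  note lay = lay0[unfolded D0] and N = N0[unfolded D0]
  note l = layoutD[OF lay]
  let ?D = "relabel (open_gap r) D" and ?rs = "map Suc rs"
  have wN: "weld L rs \<subseteq> N" unfolding N arches_def by auto
  have L: "\<exists>y. (a, y) \<in> weld L rs" if "a \<in> L" for a
  proof -
    have "a \<in> fst ` weld L rs" using that weld_facts(1)[OF l(3,4)] by simp
    then show ?thesis by auto
  qed
  have qL: "q \<notin> L" using L[of q] wN perfect_fst_snd[OF P _ q(1)] by blast
  have L2: "2 \<notin> L"
  proof
    assume "2 \<in> L"
    then obtain y where y: "(2, y) \<in> weld L rs" using L by blast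
    then have "y = q" using wN perfect_fst_unique[OF P _ q(1)] by blast
    with y \<open>(2, q) \<notin> weld L rs\<close> show False by simp
  qed
  obtain v where v: "v \<in> insert q L" "card {x \<in> insert q L. x < v} = card {x \<in> insert q L. q < x}"
    and step: "nest_step r q (arches r (insert (2, q) D) L rs) = relabel (close_gap 2)
      (arches (Suc r) (insert (v, r) ?D) (insert q L - {v}) ?rs)"
    using nest_step_arches[OF lay Dq q2 q(2) qL L2] by blast
  have og: "open_gap r 2 = 2" "open_gap r q = q" using q2 q(2) by (simp_all add: open_gap_def)
  note opened = relabel_layout[OF lay, unfolded relabel_simps map_prod_simp og]
  have vr: "1 < v" "v < r" using v(1) q2 q(2) l(6) by auto
  have "card (insert q L - {v}) = card L" using v(1) qL l(3) by simp
  then have lay': "layout (Suc r) (insert (v, r) ?D) (insert q L - {v}) ?rs"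
    using opened(1) q(2) q2 vr unfolding layout_def by auto
  have layD: "layout (Suc r) ?D L ?rs" and layD': "layout (Suc r) ?D (insert q L - {v}) ?rs"
    using opened(1) lay' unfolding layout_def by auto
  define S where "S = {1..Suc (2 * m)} - {r}"
  have P': "perfect S (insert (2, q) (arches (Suc r) ?D L ?rs))"
    using perfect_relabel_open_gap[OF P r] unfolding N opened(2) unfolding arches_insert S_def .
  have m: "r \<in> {1..2 * m}" "2 \<in> {1..2 * m}" "q \<in> {1..2 * m}"
    using perfect_vertex[OF P] r q by blast+
  have "fst ` weld L ?rs \<subseteq> S"
    using perfectD(6)[OF P'] unfolding arches_def by auto
  then have LS: "L \<subseteq> S"
    unfolding weld_facts(1)[OF layoutD(3,4)[OF layD]] .
  have "(2, q) \<notin> arches (Suc r) ?D L ?rs"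
  proof
    assume "(2, q) \<in> arches (Suc r) ?D L ?rs"
    moreover have "(2, q) \<notin> weld L ?rs" using weld_mem(5)[OF layD, of "(2, q)"] q(2) by auto
    ultimately have "(2, q) \<in> ?D" unfolding arches_def by simp
    then have "map_prod (open_gap r) (open_gap r) (2, q) \<in> map_prod (open_gap r) (open_gap r) ` D"
      unfolding relabel_def map_prod_simp og .
    then have "(2, q) \<in> D"
      using prod.inj_map[OF inj_open_gap inj_open_gap] by (simp only: inj_image_mem_iff)
    with Dq show False by simp
  qed
  \<comment> \<open>The step is carried out in three moves: removing (2, q) vacates 2 and q, the
    exchange of L for V without v occupies q and vacates v (or changes nothing if v = q), and the
    new edge occupies v and r. Only 2 remains free.\<close>
  then have "perfect (S - {2, q}) (arches (Suc r) ?D L ?rs)"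
    using perfect_remove[OF P', of 2 q] by simp
  moreover have "(insert q L - {v}) \<inter> (S - {2, q} - L) = {}" by auto
  ultimately have "perfect ((S - {2, q} - L) \<union> (insert q L - {v})) (arches (Suc r) ?D (insert q L - {v}) ?rs)"
    using perfect_arches_exchange[OF _ layD layD'] by simp
  from perfect_insert[OF this vr(2)]
  have "perfect (insert v (insert r ((S - {2, q} - L) \<union> (insert q L - {v}))))
      (arches (Suc r) (insert (v, r) ?D) (insert q L - {v}) ?rs)"
    using v(1) vr q(2) l(6) unfolding arches_insert by (auto simp: S_def)
  moreover have "insert v (insert r ((S - {2, q} - L) \<union> (insert q L - {v}))) = {1..Suc (2 * m)} - {2}"
    using m LS v(1) q2 q(2) L2 unfolding S_def by auto
  ultimately have "perfect ({1..Suc (2 * m)} - {2}) (arches (Suc r) (insert (v, r) ?D) (insert q L - {v}) ?rs)"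
    by simp
  then show thesis
    using that[OF lay Dq N q2 qL L2 v lay'] step unfolding N by simp
qed

lemma perfect_close_gap:
  assumes "perfect ({1..Suc (2 * m)} - {2}) A" "1 \<le> m"
  shows "perfect {1..2 * m} (relabel (close_gap 2) A)" "ne (relabel (close_gap 2) A) = ne A"
proof -
  have g: "strict_mono_on ({1..Suc (2 * m)} - {2}) (close_gap 2)"
    by (rule monotone_on_subset[OF strict_mono_close_gap]) auto
  have "close_gap 2 ` ({1..Suc (2 * m)} - {2}) = {1..2 * m}"
    using assms(2) by (intro close_gap_image) auto
  with perfect_relabel[OF assms(1) g] show "perfect {1..2 * m} (relabel (close_gap 2) A)" by simp
  show "ne (relabel (close_gap 2) A) = ne A"
    using ne_relabel[OF g perfect_subset[OF assms(1)]] .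
qed

lemma close_gap_inject:
  assumes "perfect (S - {2}) A" "perfect (S - {2}) B" "relabel (close_gap 2) A = relabel (close_gap 2) B"
  shows "A = B"
proof (rule relabel_inject[OF _ _ _ assms(3)])
  show "inj_on (close_gap 2) (S - {2})"
    using strict_mono_on_imp_inj_on[OF strict_mono_close_gap] by (rule inj_on_subset) auto
qed (use assms(1,2) perfect_subset in blast)+

text \<open>Expresses the reference count, without the first edge, in the labels in which the result
  of a step is counted.\<close>

lemma ne_remove_first:
  assumes "layout r D L rs"
  shows "ne (arches r D L rs - {(1, r)}) = ne (relabel (open_gap r) D \<union> weld L (map Suc rs))"
proof -
  have "ne (arches r D L rs - {(1, r)}) = ne (relabel (open_gap r) (arches r D L rs - {(1, r)}))"
    using ne_relabel[OF strict_mono_open_gap, of "arches r D L rs - {(1, r)}" r] by simp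
  also have "relabel (open_gap r) (arches r D L rs - {(1, r)})
      = arches (Suc r) (relabel (open_gap r) D) L (map Suc rs) - {(1, Suc r)}"
    unfolding relabel_Diff_singleton[OF inj_open_gap] relabel_layout(2)[OF assms]
    using layoutD(1)[OF assms] by (simp add: open_gap_def)
  also have "\<dots> = relabel (open_gap r) D \<union> weld L (map Suc rs)"
    using arches_parts(4)[OF relabel_layout(1)[OF assms]] .
  finally show ?thesis .
qed

text \<open>In the sum over the left endpoints the term of 2 is replaced by the term of r. The
  former counts all edges of D inside the first edge and the latter is zero, so the exchange saves
  exactly the nestings that the first edge adds. Deleting the vertex 2 turns the new left endpoint r
  into r - 1.\<close>

lemma cross_step_matching:
  assumes P: "perfect {1..2 * m} N" and r: "(1, r) \<in> N" and x: "(2, x) \<in> N" "r < x"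
  shows "perfect {1..2 * m} (cross_step r N)" "(1, r) \<in> cross_step r N"
    "\<exists>y. (r - 1, y) \<in> cross_step r N" "ne (cross_step r N) = ne (N - {(1, r)})"
proof -
  obtain D L rs where lay: "layout r D L rs" and N: "N = arches r D L rs" and L: "2 \<in> L" "r \<notin> L"
    and lay': "layout (Suc r) (relabel (open_gap r) D) (insert r (L - {2})) (map Suc rs)"
    and P': "perfect ({1..Suc (2 * m)} - {2})
      (arches (Suc r) (relabel (open_gap r) D) (insert r (L - {2})) (map Suc rs))" (is "perfect _ ?A")
    and step: "cross_step r N = relabel (close_gap 2)
      (arches (Suc r) (relabel (open_gap r) D) (insert r (L - {2})) (map Suc rs))"
    using cross_step_arches_exist[OF assms] by metis
  let ?D = "relabel (open_gap r) D" and ?rs = "map Suc rs"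
  note opened = relabel_layout[OF lay]
  have "1 \<le> m" using perfect_vertex[OF P r] by auto
  note closed = perfect_close_gap[OF P' this, folded step]
  show "perfect {1..2 * m} (cross_step r N)" by (rule closed(1))
  have r2: "2 < r" using layoutD(6)[OF lay L(1)] by simp
  have mem: "map_prod (close_gap 2) (close_gap 2) e \<in> cross_step r N" if "e \<in> ?A" for e
    using imageI[OF that] unfolding step relabel_def[of "close_gap 2"] .
  have "(1, Suc r) \<in> ?A" by (simp add: arches_def)
  from mem[OF this] show "(1, r) \<in> cross_step r N" using r2 by (simp add: close_gap_def)
  have "r \<in> fst ` weld (insert r (L - {2})) ?rs"
    using weld_facts(1)[OF layoutD(3,4)[OF lay']] by simp
  then obtain y where "(r, y) \<in> weld (insert r (L - {2})) ?rs" by auto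
  then have "(r, y) \<in> ?A" unfolding arches_def by simp
  from mem[OF this] show "\<exists>y. (r - 1, y) \<in> cross_step r N" using r2 by (auto simp: close_gap_def)
  let ?c = "\<lambda>l. card {e \<in> ?D. l < fst e \<and> snd e < Suc r}"
  \<comment> \<open>The only edge at 2 is a crossing one. Hence all edges of D start beyond 2, and
    \<open>?c 2\<close> counts every edge of D that ends before the first edge does.\<close>
  have no2: "fst e \<noteq> 2" if "e \<in> ?D" for e
  proof
    assume e: "fst e = 2"
    have PA: "perfect ({1..Suc (2 * m)} - {r}) (arches (Suc r) ?D L ?rs)"
      using perfect_relabel_open_gap[OF P r] unfolding N opened(2) .
    have "2 \<in> fst ` weld L ?rs"
      using weld_facts(1)[OF layoutD(3,4)[OF opened(1)]] L by simp
    then obtain z where z: "(2, z) \<in> weld L ?rs" by auto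
    have "(2, snd e) \<in> ?D" using that prod.collapse[of e] unfolding e by simp
    then have "(2, snd e) \<in> arches (Suc r) ?D L ?rs" "(2, z) \<in> arches (Suc r) ?D L ?rs"
      unfolding arches_def using z by simp_all
    then have "snd e = z" by (rule perfect_fst_unique[OF PA])
    then show False
      using layoutD(8)[OF opened(1) that] weld_mem(5)[OF opened(1) z] r2 unfolding e by simp
  qed
  have c2: "?c 2 = card {e \<in> ?D. snd e < Suc r}"
    using layoutD(8)[OF opened(1)] no2 by (intro arg_cong[of _ _ card]) fastforce
  have "{e \<in> ?D. r < fst e \<and> snd e < Suc r} = {}"
    using layoutD(8)[OF opened(1)] by fastforce
  then have cr: "?c r = 0" by (simp only: card.empty)
  have "(\<Sum>l\<in>insert r (L - {2}). ?c l) + ?c 2 = (\<Sum>l\<in>L. ?c l)"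
    using L(2) cr sum.insert[of "L - {2}" r ?c] sum.remove[OF layoutD(3)[OF lay] L(1), of ?c]
      layoutD(3)[OF lay] by simp
  then have "ne ?A = ne (?D \<union> weld L ?rs)"
    unfolding ne_arches[OF lay'] ne_arches(1)[OF opened(1)] c2 by simp
  then show "ne (cross_step r N) = ne (N - {(1, r)})"
    using closed(2) ne_remove_first[OF lay] unfolding N by (simp only:)
qed

text \<open>Equality of the images gives equality of the coordinates, and since 2 is in L and r is
  not, trading r back for 2 recovers L.\<close>

lemma cross_step_inject:
  assumes "perfect {1..2 * m} N" "(1, r) \<in> N" "(2, x) \<in> N" "r < x"
    and "perfect {1..2 * m} N'" "(1, r) \<in> N'" "(2, x') \<in> N'" "r < x'"
    and eq: "cross_step r N = cross_step r N'"
  shows "N = N'"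
proof -
  obtain D L rs where lay: "layout r D L rs" and N: "N = arches r D L rs" and L: "2 \<in> L" "r \<notin> L"
    and lay1: "layout (Suc r) (relabel (open_gap r) D) (insert r (L - {2})) (map Suc rs)"
    and P: "perfect ({1..Suc (2 * m)} - {2})
      (arches (Suc r) (relabel (open_gap r) D) (insert r (L - {2})) (map Suc rs))"
    and step: "cross_step r N = relabel (close_gap 2)
      (arches (Suc r) (relabel (open_gap r) D) (insert r (L - {2})) (map Suc rs))"
    using cross_step_arches_exist[OF assms(1-4)] by metis
  obtain D' L' rs' where N': "N' = arches r D' L' rs'" and L': "2 \<in> L'" "r \<notin> L'"
    and lay1': "layout (Suc r) (relabel (open_gap r) D') (insert r (L' - {2})) (map Suc rs')"
    and P': "perfect ({1..Suc (2 * m)} - {2})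
      (arches (Suc r) (relabel (open_gap r) D') (insert r (L' - {2})) (map Suc rs'))"
    and step': "cross_step r N' = relabel (close_gap 2)
      (arches (Suc r) (relabel (open_gap r) D') (insert r (L' - {2})) (map Suc rs'))"
    using cross_step_arches_exist[OF assms(5-8)] by metis
  note inject = arches_inject[OF lay1 lay1' close_gap_inject[OF P P' eq[unfolded step step']]]
  have "D = D'" using inject(1) by (rule relabel_open_gap_inject)
  moreover have "M = insert 2 (insert r (M - {2}) - {r})" if "2 \<in> M" "r \<notin> M" for M
    using that by auto
  then have "L = L'" using inject(2) L L' by metis
  moreover have "rs = rs'" using inject(3) by simp
  ultimately show ?thesis unfolding N N' by simp
qed

text \<open>In the image v is the partner of the vertex r, which determines D and then V by
  returning v to the set of left endpoints. The number of elements below v prescribes how many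
  elements of V lie above q, and this number differs for different elements of V.\<close>

lemma nest_step_inject:
  assumes "perfect {1..2 * m} N" "(1, r) \<in> N" "(2, q) \<in> N" "q < r"
    and "perfect {1..2 * m} N'" "(1, r) \<in> N'" "(2, q') \<in> N'" "q' < r"
    and eq: "nest_step r q N = nest_step r q' N'"
  shows "N = N'"
proof -
  obtain D L rs v where fin: "layout r (insert (2, q) D) L rs" and "(2, q) \<notin> D"
    and N: "N = arches r (insert (2, q) D) L rs" and "2 < q" and L: "q \<notin> L" and "2 \<notin> L"
    and v: "v \<in> insert q L" "card {x \<in> insert q L. x < v} = card {x \<in> insert q L. q < x}"
    and lay: "layout (Suc r) (insert (v, r) (relabel (open_gap r) D)) (insert q L - {v}) (map Suc rs)"
    and P: "perfect ({1..Suc (2 * m)} - {2})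
      (arches (Suc r) (insert (v, r) (relabel (open_gap r) D)) (insert q L - {v}) (map Suc rs))"
    and step: "nest_step r q N = relabel (close_gap 2)
      (arches (Suc r) (insert (v, r) (relabel (open_gap r) D)) (insert q L - {v}) (map Suc rs))"
    by (rule nest_step_arches_exist[OF assms(1-4)])
  obtain D' L' rs' v' where fin': "layout r (insert (2, q') D') L' rs'" and "(2, q') \<notin> D'"
    and N': "N' = arches r (insert (2, q') D') L' rs'" and "2 < q'" and L': "q' \<notin> L'" and "2 \<notin> L'"
    and v': "v' \<in> insert q' L'" "card {x \<in> insert q' L'. x < v'} = card {x \<in> insert q' L'. q' < x}"
    and lay': "layout (Suc r) (insert (v', r) (relabel (open_gap r) D')) (insert q' L' - {v'}) (map Suc rs')"
    and P': "perfect ({1..Suc (2 * m)} - {2})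
      (arches (Suc r) (insert (v', r) (relabel (open_gap r) D')) (insert q' L' - {v'}) (map Suc rs'))"
    and step': "nest_step r q' N' = relabel (close_gap 2)
      (arches (Suc r) (insert (v', r) (relabel (open_gap r) D')) (insert q' L' - {v'}) (map Suc rs'))"
    by (rule nest_step_arches_exist[OF assms(5-8)])
  note same = close_gap_inject[OF P P' eq[unfolded step step']]
  note inject = arches_inject[OF lay lay' same]
  have "v = v'"
  proof (rule perfect_snd_unique[OF P])
    show "(v', r) \<in> arches (Suc r) (insert (v, r) (relabel (open_gap r) D)) (insert q L - {v}) (map Suc rs)"
      unfolding same by (simp add: arches_def)
  qed (simp add: arches_def)
  have notin: "(w, r) \<notin> relabel (open_gap r) M" for w M
    by (auto simp: relabel_def open_gap_def split: if_splits)
  have "relabel (open_gap r) D = relabel (open_gap r) D'"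
    using inject(1) notin unfolding \<open>v = v'\<close> by (simp add: insert_ident)
  then have D: "D = D'" by (rule relabel_open_gap_inject)
  have V: "insert q L = insert q' L'"
    using inject(2) insert_Diff[OF v(1)] insert_Diff[OF v'(1)] unfolding \<open>v = v'\<close> by metis
  have "finite (insert q L)" using layoutD(3)[OF fin] by simp
  \<comment> \<open>Passing from b to a smaller a adds at least b itself to the elements
    above.\<close>
  then have less: "card {x \<in> insert q L. b < x} < card {x \<in> insert q L. a < x}"
    if "b \<in> insert q L" "a < b" for a b
    using that by (intro psubset_card_mono) auto
  have "card {x \<in> insert q L. q < x} = card {x \<in> insert q L. q' < x}"
    using v(2) v'(2) unfolding \<open>v = v'\<close> V by simp
  moreover have "q \<in> insert q L" "q' \<in> insert q L"
    using insertI1[of q' L', folded V] by simp_all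
  ultimately have "\<not> q < q'" "\<not> q' < q" using less[of q' q] less[of q q'] by linarith+
  then have q: "q = q'" by simp
  then have "L = L'" using V L L' by (metis Diff_insert_absorb)
  moreover have "rs = rs'" using inject(3) by simp
  ultimately show ?thesis unfolding N N' D q by simp
qed

text \<open>
  The gain \<open>r - q\<close> arises as one for each vertex strictly between \<open>q\<close> and \<open>r\<close>, and one for the new edge
  nested in the first edge.
\<close>

lemma ne_nest_exchange:
  assumes lay: "layout (Suc r) (insert (2, q) D) L rs"
    and lay': "layout (Suc r) (insert (v, r) D) (insert q L - {v}) rs"
    and P: "perfect T D" and T: "2 \<notin> T" "q \<notin> T" "r \<notin> T" "L \<inter> T = {}"
      "{q<..<r} \<subseteq> L \<union> T"
    and q: "2 < q" "q < r" "q \<notin> L" "2 \<notin> L" and Lr: "\<And>l. l \<in> L \<Longrightarrow> l < r"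
    and v: "v \<in> insert q L" "card {x \<in> insert q L. x < v} = card {x \<in> insert q L. q < x}"
  shows "ne (arches (Suc r) (insert (v, r) D) (insert q L - {v}) rs)
    = ne (insert (2, q) D \<union> weld L rs) + (r - q)"
proof -
  \<comment> \<open>The contribution of a left endpoint l to the nesting count. It is defined for q
    and v as well, so that the sums over L and over \<open>insert q L - {v}\<close> become
    comparable.\<close>
  define c where "c = (\<lambda>l. card {e \<in> D. l < fst e \<and> snd e < Suc r})"
  have nst: "nested e g \<longleftrightarrow> fst e < fst g \<and> fst g < snd g \<and> snd g < snd e" for e g
    by (cases e; cases g) simp
  have fin: "finite D" "finite L" using layoutD(2,3)[OF lay] by simp_all
  have D: "2 < fst e" "fst e < snd e" "snd e < r \<or> Suc r < fst e" "fst e \<noteq> q" "snd e \<noteq> q"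
    "snd e \<noteq> r" if "e \<in> D" for e
  proof -
    have "fst e \<in> T" "snd e \<in> T" using perfect_vertex[OF P, of "fst e" "snd e"] that by simp_all
    then have ne: "fst e \<noteq> 2" "fst e \<noteq> q" "snd e \<noteq> q" "fst e \<noteq> r" "snd e \<noteq> r"
      using T by auto
    have "1 < fst e \<and> fst e < snd e \<and> (snd e < Suc r \<or> Suc r < fst e)"
      using layoutD(8)[OF lay, of e] that by simp
    with ne show "2 < fst e" "fst e < snd e" "snd e < r \<or> Suc r < fst e" "fst e \<noteq> q" "snd e \<noteq> q"
      "snd e \<noteq> r" by auto
  qed
  have L2: "2 < l" if "l \<in> L" for l
    using that q(4) layoutD(6)[OF lay, of l] by (cases "l = 2") auto
  have vr: "v < r" "2 < v" using v(1) q(1,2) Lr[of v] L2[of v] by blast+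
  have notin: "(2, q) \<notin> D" "(v, r) \<notin> D" using D(1)[of "(2, q)"] D(6)[of "(v, r)"] by auto
  have "{e \<in> D. nested (2, q) e} = {e \<in> D. snd e < q}" "{e \<in> D. nested e (2, q)} = {}"
    using D(1,2) unfolding nst by fastforce+
  then have ne1: "ne (insert (2, q) D) = ne D + card {e \<in> D. snd e < q}"
    using ne_insert[OF fin(1) notin(1)] by (simp only: card.empty)
  have "{e \<in> D. nested (v, r) e} = {e \<in> D. v < fst e \<and> snd e < Suc r}" "{e \<in> D. nested e (v, r)} = {}"
    using D(2,3) vr unfolding nst by fastforce+
  then have ne2: "ne (insert (v, r) D) = ne D + c v"
    using ne_insert[OF fin(1) notin(2)] unfolding c_def by (simp only: card.empty)
  have c1: "card {e \<in> insert (2, q) D. l < fst e \<and> snd e < Suc r} = c l" if "l \<in> L" for l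
  proof -
    have "{e \<in> insert (2, q) D. l < fst e \<and> snd e < Suc r} = {e \<in> D. l < fst e \<and> snd e < Suc r}"
      using L2[OF that] by auto
    then show ?thesis by (simp only: c_def)
  qed
  have c2: "card {e \<in> insert (v, r) D. l < fst e \<and> snd e < Suc r} = c l + (if l < v then 1 else 0)" for l
  proof (cases "l < v")
    case True
    then have "{e \<in> insert (v, r) D. l < fst e \<and> snd e < Suc r}
        = insert (v, r) {e \<in> D. l < fst e \<and> snd e < Suc r}"
      by auto
    then show ?thesis using True notin(2) fin(1) by (simp add: c_def)
  next
    case False
    then have "{e \<in> insert (v, r) D. l < fst e \<and> snd e < Suc r} = {e \<in> D. l < fst e \<and> snd e < Suc r}"
      by auto
    then show ?thesis using False by (simp add: c_def)
  qed
  have o: "{e \<in> insert (2, q) D. Suc r < fst e \<and> snd e < x} = {e \<in> D. Suc r < fst e \<and> snd e < x}"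
    "{e \<in> insert (v, r) D. Suc r < fst e \<and> snd e < x} = {e \<in> D. Suc r < fst e \<and> snd e < x}" for x
    using q vr by auto
  have "{e \<in> insert (v, r) D. snd e < Suc r} = insert (v, r) {e \<in> D. snd e < Suc r}"
    by auto
  then have i1: "card {e \<in> insert (v, r) D. snd e < Suc r} = Suc (card {e \<in> D. snd e < Suc r})"
    using notin(2) fin(1) by simp
  \<comment> \<open>The edges of D inside the first edge are now counted where those inside (2, q)
    were counted before. The gain consists of the edges ending beyond q.\<close>
  have "{e \<in> D. snd e < Suc r} = {e \<in> D. snd e < q} \<union> {e \<in> D. q < snd e \<and> snd e < Suc r}"
    using D(5) q(2) by fastforce
  moreover have "{e \<in> D. snd e < q} \<inter> {e \<in> D. q < snd e \<and> snd e < Suc r} = {}" by auto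
  ultimately have i2: "card {e \<in> D. snd e < Suc r}
      = card {e \<in> D. snd e < q} + card {e \<in> D. q < snd e \<and> snd e < Suc r}"
    using fin(1) by (simp add: card_Un_disjoint)
  \<comment> \<open>These are the crossing edges that contain (v, r). The choice of v makes their
    number equal to the number of elements of V above q.\<close>
  have "(\<Sum>l\<in>insert q L - {v}. if l < v then 1 else 0) = card {x \<in> insert q L - {v}. x < v}"
    using fin(2) by (simp add: sum.inter_filter[symmetric])
  also have "{x \<in> insert q L - {v}. x < v} = {x \<in> insert q L. x < v}" by auto
  finally have s1: "(\<Sum>l\<in>insert q L - {v}. c l + (if l < v then 1 else 0))
      = (\<Sum>l\<in>insert q L - {v}. c l) + card {x \<in> insert q L. q < x}"
    unfolding sum.distrib v(2) by simp
  \<comment> \<open>The term \<open>c v\<close> missing from the new sum is supplied by the edges of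
    D nested in (v, r). Both sides are therefore the sum over all of V, whatever v is, and the
    surplus over the old sum is \<open>c q\<close>.\<close>
  have s2: "(\<Sum>l\<in>insert q L - {v}. c l) + c v = (\<Sum>l\<in>L. c l) + c q"
  proof -
    have "(\<Sum>l\<in>insert q L. c l) = c v + (\<Sum>l\<in>insert q L - {v}. c l)"
      using fin(2) v(1) by (intro sum.remove) auto
    moreover have "(\<Sum>l\<in>insert q L. c l) = c q + (\<Sum>l\<in>L. c l)"
      using fin(2) q(3) by (intro sum.insert) auto
    ultimately show ?thesis by simp
  qed
  let ?X = "{x \<in> insert q L. q < x}" and ?Y = "{e \<in> D. q < fst e \<and> snd e < Suc r}"
    and ?Z = "{e \<in> D. q < snd e \<and> snd e < Suc r}"
  have YT: "fst ` ?Y \<subseteq> fst ` D" "snd ` ?Z \<subseteq> snd ` D" by auto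
  \<comment> \<open>The three sources of gain, found above, match the three kinds of vertices
    between q and r. No right endpoint of a crossing edge occurs, since these lie beyond r.\<close>
  have "{q<..<r} = ?X \<union> fst ` ?Y \<union> snd ` ?Z"
  proof (intro equalityI subsetI)
    fix w assume w: "w \<in> {q<..<r}"
    then consider "w \<in> L" | "w \<in> T" using T(5) by blast
    then show "w \<in> ?X \<union> fst ` ?Y \<union> snd ` ?Z"
    proof cases
      case 1
      then show ?thesis using w by simp
    next
      case 2
      then obtain z where "(w, z) \<in> D \<or> (z, w) \<in> D" using perfect_cover[OF P] by blast
      then show ?thesis
      proof
        assume z: "(w, z) \<in> D"
        then have "(w, z) \<in> ?Y" using w D(3)[OF z] by auto
        from imageI[OF this, of fst] show ?thesis by simp
      next
        assume "(z, w) \<in> D"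
        then have "(z, w) \<in> ?Z" using w by simp
        from imageI[OF this, of snd] show ?thesis by simp
      qed
    qed
  next
    fix w assume "w \<in> ?X \<union> fst ` ?Y \<union> snd ` ?Z"
    then consider "w \<in> ?X" | e where "e \<in> ?Y" "w = fst e" | e where "e \<in> ?Z" "w = snd e" by blast
    then show "w \<in> {q<..<r}"
    proof cases
      case 1
      then show ?thesis using Lr by auto
    next
      case 2
      then show ?thesis using D(2,3)[of e] by auto
    next
      case 3
      then show ?thesis using D(6)[of e] by auto
    qed
  qed
  moreover have "?X \<inter> (fst ` ?Y \<union> snd ` ?Z) = {}"
  proof -
    have "?X \<subseteq> L" by auto
    moreover have "fst ` ?Y \<union> snd ` ?Z \<subseteq> T" using YT perfectD(5)[OF P] by blast
    ultimately show ?thesis using T(4) by blast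
  qed
  moreover have "fst ` ?Y \<inter> snd ` ?Z = {}" using YT perfectD(4)[OF P] by blast
  ultimately have "card {q<..<r} = card ?X + (card (fst ` ?Y) + card (snd ` ?Z))"
    using fin by (simp add: card_Un_disjoint Un_assoc)
  moreover have "card (fst ` ?Y) = c q" "card (snd ` ?Z) = card ?Z"
    using perfectD(2,3)[OF P] unfolding c_def
    by (auto intro!: card_image intro: inj_on_subset)
  ultimately have gap: "r - q = Suc (card ?X + (c q + card ?Z))" using q(2) by simp
  have "ne (arches (Suc r) (insert (v, r) D) (insert q L - {v}) rs)
    = ne D + c v + inversions rs + ((\<Sum>l\<in>insert q L - {v}. c l) + card ?X)
      + (\<Sum>x\<in>set rs. card {e \<in> D. Suc r < fst e \<and> snd e < x}) + Suc (card {e \<in> D. snd e < Suc r})"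
    unfolding ne_arches[OF lay'] ne2 c2 s1 o i1 ..
  moreover have "ne (insert (2, q) D \<union> weld L rs)
    = ne D + card {e \<in> D. snd e < q} + inversions rs + (\<Sum>l\<in>L. c l)
      + (\<Sum>x\<in>set rs. card {e \<in> D. Suc r < fst e \<and> snd e < x})"
    unfolding ne_arches(1)[OF lay] ne1 o using c1 by (simp cong: sum.cong)
  ultimately show ?thesis using s2 i2 gap by simp
qed

lemma nest_step_matching:
  assumes P: "perfect {1..2 * m} N" and r: "(1, r) \<in> N" and q: "(2, q) \<in> N" "q < r"
  shows "perfect {1..2 * m} (nest_step r q N)" "(1, r) \<in> nest_step r q N"
    "\<exists>y. (y, r - 1) \<in> nest_step r q N"
    "ne (nest_step r q N) = ne (N - {(1, r)}) + (r - q)"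
proof -
  obtain D L rs v where lay: "layout r (insert (2, q) D) L rs" and "(2, q) \<notin> D"
    and N: "N = arches r (insert (2, q) D) L rs" and q2: "2 < q" and L: "q \<notin> L" "2 \<notin> L"
    and v: "v \<in> insert q L" "card {x \<in> insert q L. x < v} = card {x \<in> insert q L. q < x}"
    and lay': "layout (Suc r) (insert (v, r) (relabel (open_gap r) D)) (insert q L - {v}) (map Suc rs)"
    and P': "perfect ({1..Suc (2 * m)} - {2})
      (arches (Suc r) (insert (v, r) (relabel (open_gap r) D)) (insert q L - {v}) (map Suc rs))"
    and step: "nest_step r q N = relabel (close_gap 2)
      (arches (Suc r) (insert (v, r) (relabel (open_gap r) D)) (insert q L - {v}) (map Suc rs))"
    by (rule nest_step_arches_exist[OF assms])
  let ?D = "relabel (open_gap r) D" and ?rs = "map Suc rs"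
  let ?A = "arches (Suc r) (insert (v, r) ?D) (insert q L - {v}) ?rs"
  have "1 \<le> m" using perfect_vertex[OF P r] by auto
  note closed = perfect_close_gap[OF P' this, folded step]
  show "perfect {1..2 * m} (nest_step r q N)" by (rule closed(1))
  have mem: "map_prod (close_gap 2) (close_gap 2) e \<in> nest_step r q N" if "e \<in> ?A" for e
    using imageI[OF that] unfolding step relabel_def[of "close_gap 2"] .
  have "(1, Suc r) \<in> ?A" by (simp add: arches_def)
  from mem[OF this] show "(1, r) \<in> nest_step r q N" using q2 q(2) by (simp add: close_gap_def)
  have "(v, r) \<in> ?A" by (simp add: arches_def)
  from mem[OF this] show "\<exists>y. (y, r - 1) \<in> nest_step r q N"
    using q2 q(2) by (auto simp: close_gap_def)
  have og: "open_gap r 2 = 2" "open_gap r q = q" using q2 q(2) by (simp_all add: open_gap_def)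
  note opened = relabel_layout[OF lay, unfolded relabel_simps map_prod_simp og]
  define S where "S = {1..Suc (2 * m)} - {r}"
  have PS: "perfect S (arches (Suc r) (insert (2, q) ?D) L ?rs)"
    using perfect_relabel_open_gap[OF P r] unfolding N opened(2) S_def .
  note lD = layoutD[OF opened(1)]
  note W = weld_facts[OF lD(3,4)]
  have m: "r \<in> {1..2 * m}" "q \<in> {1..2 * m}" using perfect_vertex[OF P] r q by blast+
  have notin: "(2, q) \<notin> ?D"
  proof
    assume "(2, q) \<in> ?D"
    then have "map_prod (open_gap r) (open_gap r) (2, q) \<in> map_prod (open_gap r) (open_gap r) ` D"
      unfolding relabel_def map_prod_simp og .
    then have "(2, q) \<in> D"
      using prod.inj_map[OF inj_open_gap inj_open_gap] by (simp only: inj_image_mem_iff)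
    with \<open>(2, q) \<notin> D\<close> show False by simp
  qed
  have "weld L ?rs \<subseteq> arches (Suc r) (insert (2, q) ?D) L ?rs" by (auto simp: arches_def)
  from perfect_Diff[OF PS this]
  have 1: "perfect (S - (L \<union> set ?rs)) (insert (1, Suc r) (insert (2, q) ?D))"
    unfolding arches_parts(2)[OF opened(1)] W(1,2) .
  have "(1, Suc r) \<notin> insert (2, q) ?D" using lD(8)[of "(1, Suc r)"] by auto
  then have "insert (1, Suc r) (insert (2, q) ?D) - {(1, Suc r)} = insert (2, q) ?D" by blast
  with perfect_remove[OF 1, of 1 "Suc r"]
  have 2: "perfect (S - (L \<union> set ?rs) - {1, Suc r}) (insert (2, q) ?D)" by simp
  \<comment> \<open>What is left for D after the crossing edges, the first edge and (2, q) have been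
    peeled off.\<close>
  define T where "T = S - (L \<union> set ?rs) - {1, Suc r} - {2, q}"
  have PT: "perfect T ?D"
    using perfect_remove[OF 2, of 2 q] notin unfolding T_def by simp
  \<comment> \<open>A vertex in this range differs from 1, 2, q, r and \<open>Suc r\<close> and is
    too small to be a right endpoint of a crossing edge.\<close>
  have gap: "{q<..<r} \<subseteq> L \<union> T"
  proof
    fix w assume w: "w \<in> {q<..<r}"
    then have "w \<notin> set ?rs" using lD(7)[of w] by auto
    then show "w \<in> L \<union> T" using w q2 m unfolding T_def S_def by auto
  qed
  have "ne ?A = ne (insert (2, q) ?D \<union> weld L ?rs) + (r - q)"
    by (rule ne_nest_exchange[OF opened(1) lay' PT _ _ _ _ gap q2 q(2) L _ v])
      (use layoutD(6)[OF lay] in \<open>auto simp: T_def S_def\<close>)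
  then show "ne (nest_step r q N) = ne (N - {(1, r)}) + (r - q)"
    using closed(2) ne_remove_first[OF lay] unfolding N relabel_simps map_prod_simp og by (simp only:)
qed

subsection \<open>Removing the first edge\<close>

definition open_gaps :: "nat \<Rightarrow> nat \<Rightarrow> nat" where
  "open_gaps r = open_gap r \<circ> open_gap 1"

lemma strict_mono_open_gaps: "strict_mono (open_gaps r)"
  unfolding open_gaps_def
  using strict_mono_open_gap by (auto simp: strict_mono_def)

lemma atLeastAtMost_remove_first: "{1..Suc k} - {1} = {2..Suc k}"
  by auto

lemma open_gaps_image:
  assumes "2 \<le> r" "r \<le> 2 * Suc n"
  shows "open_gaps r ` {1..2 * n} = {1..2 * Suc n} - {1, r}"
proof -
  have "open_gap 1 ` {1..2 * n} = {2..Suc (2 * n)}"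
    using open_gap_image[of 1 1 "2 * n"] atLeastAtMost_remove_first[of "2 * n"] by simp
  moreover have "open_gap r ` {2..Suc (2 * n)} = {2..Suc (Suc (2 * n))} - {r}"
    using assms by (intro open_gap_image) auto
  moreover have "{2..Suc (Suc (2 * n))} - {r} = {1..2 * Suc n} - {1, r}" by auto
  ultimately show ?thesis unfolding open_gaps_def image_comp[symmetric] by simp
qed

lemma perfect_first_edge:
  assumes "perfect {1..2 * Suc n} M"
  obtains r where "(1, r) \<in> M" "2 \<le> r" "r \<le> 2 * Suc n"
proof -
  have "1 \<in> {1..2 * Suc n}" by simp
  then obtain w where w: "(1, w) \<in> M \<or> (w, 1) \<in> M" using perfect_cover[OF assms] by blast
  have "(w, 1) \<notin> M"
    using perfect_less[OF assms, of w 1] perfect_vertex[OF assms, of w 1] by auto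
  with w have "(1, w) \<in> M" by simp
  then show thesis
    using that[of w] perfect_less[OF assms, of 1 w] perfect_vertex[OF assms, of 1 w] by auto
qed

lemma put_back_edge1_eq: "put_back_edge1 r N = insert (1, r) (relabel (open_gaps r) N)"
  by (simp add: put_back_edge1_def open_gaps_def)

lemma perfect_put_back:
  assumes N: "perfect {1..2 * n} N" and r: "2 \<le> r" "r \<le> 2 * Suc n"
  shows "perfect {1..2 * Suc n} (put_back_edge1 r N)"
    "put_back_edge1 r N - {(1, r)} = relabel (open_gaps r) N"
    "ne (put_back_edge1 r N - {(1, r)}) = ne N"
proof -
  have "perfect ({1..2 * Suc n} - {1, r}) (relabel (open_gaps r) N)"
    unfolding open_gaps_image[OF r, symmetric]
    by (rule perfect_relabel[OF N monotone_on_subset[OF strict_mono_open_gaps subset_UNIV]])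
  note R = this
  have "insert 1 (insert r ({1..2 * Suc n} - {1, r})) = {1..2 * Suc n}" using r by auto
  with perfect_insert[OF R, of 1 r] show "perfect {1..2 * Suc n} (put_back_edge1 r N)"
    unfolding put_back_edge1_eq using r by simp
  show *: "put_back_edge1 r N - {(1, r)} = relabel (open_gaps r) N"
    using perfect_vertex[OF R, of 1 r] unfolding put_back_edge1_eq by auto
  show "ne (put_back_edge1 r N - {(1, r)}) = ne N"
    unfolding * by (rule ne_relabel[OF strict_mono_open_gaps]) simp
qed

lemma put_back_edge1_inject:
  assumes "perfect {1..2 * n} N" "perfect {1..2 * n} N'" "2 \<le> r" "r \<le> 2 * Suc n"
    and "put_back_edge1 r N = put_back_edge1 r N'"
  shows "N = N'"
proof -
  have "relabel (open_gaps r) N = relabel (open_gaps r) N'"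
    using assms(5) perfect_put_back(2)[OF assms(1,3,4)] perfect_put_back(2)[OF assms(2-4)] by simp
  then show ?thesis
    using relabel_inject[of "open_gaps r" UNIV N N'] strict_mono_imp_inj_on[OF strict_mono_open_gaps]
    by simp
qed

lemma perfect_remove_edge1:
  assumes M: "perfect {1..2 * Suc n} M" and e: "(1, r) \<in> M"
  shows "perfect {1..2 * n} (remove_edge1 r M)" "put_back_edge1 r (remove_edge1 r M) = M"
proof -
  have r: "2 \<le> r" "r \<le> 2 * Suc n"
    using perfect_less[OF M e] perfect_vertex[OF M e] by auto
  let ?h = "close_gap 1 \<circ> close_gap r"
  let ?S = "{1..2 * Suc n} - {1, r}"
  have R: "perfect ?S (M - {(1, r)})" by (rule perfect_remove[OF M e])
  have inv: "?h (open_gaps r v) = v" for v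
    by (simp add: open_gaps_def close_open_gap)
  \<comment> \<open>On \<open>?S\<close> the renumbering inverts \<open>open_gaps r\<close>, so it
    inherits strict monotonicity without a case analysis on positions.\<close>
  have mono: "strict_mono_on ?S ?h"
  proof (rule strict_mono_onI)
    fix v w assume vw: "v \<in> ?S" "w \<in> ?S" "v < w"
    then obtain v' w' where "v = open_gaps r v'" "w = open_gaps r w'"
      unfolding open_gaps_image[OF r, symmetric] by blast
    with vw(3) show "?h v < ?h w"
      unfolding inv using strict_mono_less[OF strict_mono_open_gaps] by (simp only: inv)
  qed
  have "?h ` ?S = {1..2 * n}"
    unfolding open_gaps_image[OF r, symmetric] image_image inv by simp
  with perfect_relabel[OF R mono] show "perfect {1..2 * n} (remove_edge1 r M)"
    unfolding remove_edge1_def by simp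
  have "open_gaps r (?h v) = v" if v: "v \<in> ?S" for v
  proof -
    obtain v' where "v = open_gaps r v'" using v unfolding open_gaps_image[OF r, symmetric] by blast
    then show ?thesis by (simp only: inv)
  qed
  then have "relabel (open_gaps r \<circ> ?h) (M - {(1, r)}) = M - {(1, r)}"
    using perfect_vertex[OF R] by (intro relabel_id_on) (simp only: o_apply)
  then show "put_back_edge1 r (remove_edge1 r M) = M"
    unfolding put_back_edge1_eq remove_edge1_def relabel_relabel using e by auto
qed

text \<open>No edge starts before (1, r), so removing it drops the head of the list, and the
  monotone renumbering keeps the order of the rest. This locates the second edge and shifts every
  position in \<open>st\<close> by one.\<close>

lemma by_left_Cons:
  assumes M: "perfect {1..2 * Suc n} M" and e: "(1, r) \<in> M"
  shows "by_left M = (1, r) # map (map_prod (open_gaps r) (open_gaps r)) (by_left (remove_edge1 r M))"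
proof -
  have r: "2 \<le> r" "r \<le> 2 * Suc n"
    using perfect_less[OF M e] perfect_vertex[OF M e] by auto
  note M1 = perfect_remove_edge1[OF M e]
  have "finite (remove_edge1 r M)" using perfect_finite[OF M1(1)] by simp
  then have R: "by_left (M - {(1, r)})
      = map (map_prod (open_gaps r) (open_gaps r)) (by_left (remove_edge1 r M))"
    using perfect_put_back(2)[OF M1(1) r] M1(2) perfect_inj(1)[OF M1(1)]
      by_left_relabel[OF _ _ strict_mono_open_gaps, of "remove_edge1 r M" r] by simp
  have P: "perfect ({1..2 * Suc n} - {1, r}) (M - {(1, r)})" by (rule perfect_remove[OF M e])
  have "finite (M - {(1, r)})" using perfect_finite[OF P] by simp
  note p = by_left_props[OF this perfect_inj(1)[OF P]]
  have gt: "1 < fst f" if "f \<in> M - {(1, r)}" for f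
    using perfect_vertex[OF P, of "fst f" "snd f"] that by auto
  have "sorted_wrt (<) (map fst ((1, r) # by_left (M - {(1, r)})))"
    using p(1,2) gt by auto
  moreover have "set ((1, r) # by_left (M - {(1, r)})) = M" using p(1) e by auto
  ultimately show ?thesis
    using by_left_unique[of "(1, r) # by_left (M - {(1, r)})"] R by simp
qed

text \<open>The value at a position involves the edge there and later edges only, so the first edge
  has no influence on later positions. A strictly monotone renumbering preserves the nesting test
  and the number of counted vertices.\<close>

lemma st_at_Cons:
  assumes es: "by_left M = e # map (map_prod g g) (by_left M')" and g: "strict_mono g"
    and i: "Suc i < length (by_left M')"
  shows "st_at M (Suc i) = st_at M' i"
proof -
  let ?es = "by_left M'"
  let ?W = "{v. snd (?es ! Suc i) \<le> v \<and> v \<le> snd (?es ! i) \<and>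
    (\<exists>k>i. k < length ?es \<and> v \<in> {fst (?es ! k), snd (?es ! k)})}"
  have nth: "by_left M ! Suc k = map_prod g g (?es ! k)" if "k < length ?es" for k
    using that by (simp add: es)
  have "{v. snd (by_left M ! Suc (Suc i)) \<le> v \<and> v \<le> snd (by_left M ! Suc i) \<and>
      (\<exists>k>Suc i. k < length (by_left M) \<and> v \<in> {fst (by_left M ! k), snd (by_left M ! k)})} = g ` ?W"
    (is "?V = _")
  proof (intro equalityI subsetI)
    fix v assume v: "v \<in> ?V"
    then obtain k where k: "k > Suc i" "k < length (by_left M)" "v \<in> {fst (by_left M ! k), snd (by_left M ! k)}"
      by blast
    obtain j where j: "k = Suc j" "i < j" using k(1) by (cases k) auto
    have jl: "j < length ?es" using k(2) j(1) by (simp add: es)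
    then obtain w where w: "w \<in> {fst (?es ! j), snd (?es ! j)}" "v = g w"
      using k(3) unfolding j(1) nth[OF jl] fst_map_prod snd_map_prod by blast
    have "snd (?es ! Suc i) \<le> w \<and> w \<le> snd (?es ! i)"
      using v i unfolding w(2) by (simp add: nth strict_mono_less_eq[OF g])
    then have "w \<in> ?W" using w(1) jl j(2) by blast
    then show "v \<in> g ` ?W" unfolding w(2) by (rule imageI)
  next
    fix v assume "v \<in> g ` ?W"
    then obtain w where w: "w \<in> ?W" "v = g w" by blast
    then obtain k where k: "k > i" "k < length ?es" "w \<in> {fst (?es ! k), snd (?es ! k)}"
      by blast
    then have "Suc k > Suc i" "Suc k < length (by_left M)" "v \<in> {fst (by_left M ! Suc k), snd (by_left M ! Suc k)}"
      unfolding w(2) nth[OF k(2)] by (auto simp: es)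
    moreover have "snd (by_left M ! Suc (Suc i)) \<le> v \<and> v \<le> snd (by_left M ! Suc i)"
      using w(1) i unfolding w(2) by (simp add: nth strict_mono_less_eq[OF g])
    ultimately show "v \<in> ?V" by blast
  qed
  moreover have "card (g ` ?W) = card ?W"
    using strict_mono_imp_inj_on[OF g] by (intro card_image) (auto intro: inj_on_subset)
  moreover have "nested (by_left M ! Suc i) (by_left M ! Suc (Suc i)) \<longleftrightarrow> nested (?es ! i) (?es ! Suc i)"
    using i nested_relabel[OF g, of "?es ! i" "?es ! Suc i"] by (simp add: nth)
  ultimately show ?thesis
    unfolding st_at_def Let_def by (simp only:)
qed

lemma st_remove_edge1:
  assumes M: "perfect {1..2 * Suc (Suc k)} M" and e: "(1, r) \<in> M"
  shows "st M = st_at M 0 + st (remove_edge1 r M)"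
proof -
  note M1 = perfect_remove_edge1(1)[OF M e]
  have card: "card M = Suc (Suc k)" "card (remove_edge1 r M) = Suc k"
    using perfect_card[OF M] perfect_card[OF M1] by simp_all
  have "length (by_left (remove_edge1 r M)) = Suc k"
    using by_left_props(3)[of "remove_edge1 r M"] perfect_finite[OF M1] perfect_inj(1)[OF M1] card(2)
    by simp
  then have "st_at M (Suc i) = st_at (remove_edge1 r M) i" if "i < k" for i
    using that st_at_Cons[OF by_left_Cons[OF M e] strict_mono_open_gaps] by simp
  then show ?thesis
    unfolding st_def card by (simp add: sum.lessThan_Suc_shift del: sum.lessThan_Suc)
qed

lemma second_edge:
  assumes M: "perfect {1..2 * Suc (Suc k)} M" and e: "(1, r) \<in> M" and q: "(1, q) \<in> remove_edge1 r M"
  shows "by_left M ! 0 = (1, r)" "by_left M ! 1 = (open_gaps r 1, open_gaps r q)"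
  using by_left_Cons[OF M e] by_left_Cons[OF perfect_remove_edge1(1)[OF M e] q] by simp_all

lemma open_gaps_1: "2 < r \<Longrightarrow> open_gaps r 1 = 2" "open_gaps 2 1 = 3"
  by (simp_all add: open_gaps_def open_gap_def)

text \<open>The edges after the first one cover every vertex except 1 and r. So in the nested case
  the counted vertices are those from the right endpoint of the second edge up to r - 1. In the
  crossed case that right endpoint exceeds r, and subtraction of naturals gives the value 0, so one
  formula serves both cases.\<close>

lemma st_at_0:
  assumes M: "perfect {1..2 * Suc (Suc k)} M" and e: "(1, r) \<in> M" and q: "(1, q) \<in> remove_edge1 r M"
  shows "r = 2 \<Longrightarrow> st_at M 0 = 0"
    "2 < r \<Longrightarrow> st_at M 0 = r - open_gaps r q"
proof -
  note s = second_edge[OF M e q]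
  have M1: "put_back_edge1 r (remove_edge1 r M) = M" by (rule perfect_remove_edge1(2)[OF M e])
  show "st_at M 0 = 0" if "r = 2"
    unfolding st_at_def Let_def using s open_gaps_1 that by simp
  assume r2: "2 < r"
  let ?q = "open_gaps r q"
  show "st_at M 0 = r - ?q"
  proof (cases "?q < r")
    case False
    then show ?thesis unfolding st_at_def Let_def using s open_gaps_1 r2 by simp
  next
    case True
    have "map_prod (open_gaps r) (open_gaps r) (1, q) \<in> M"
      using q M1 unfolding put_back_edge1_eq relabel_def by blast
    then have q': "(2, ?q) \<in> M" using open_gaps_1(1)[OF r2] by simp
    have P: "perfect ({1..2 * Suc (Suc k)} - {1, r}) (M - {(1, r)})" by (rule perfect_remove[OF M e])
    obtain xs where xs: "by_left M = (1, r) # xs" using by_left_Cons[OF M e] by blast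
    have fin: "finite M" using perfect_finite[OF M] by simp
    have "set (by_left M) = M" "distinct (by_left M)"
      using by_left_props[OF fin perfect_inj(1)[OF M]] by (auto simp: strict_sorted_iff distinct_map)
    then have set_xs: "set xs = M - {(1, r)}" unfolding xs by auto
    have "(\<exists>k>0. k < length (by_left M) \<and> v \<in> {fst (by_left M ! k), snd (by_left M ! k)})
        \<longleftrightarrow> (\<exists>f\<in>set xs. v \<in> {fst f, snd f})" for v
    proof
      assume "\<exists>k>0. k < length (by_left M) \<and> v \<in> {fst (by_left M ! k), snd (by_left M ! k)}"
      then obtain j where "j > 0" "j < length (by_left M)" "v \<in> {fst (by_left M ! j), snd (by_left M ! j)}"
        by blast
      moreover from this obtain i where "j = Suc i" by (cases j) auto
      ultimately have "xs ! i \<in> set xs" "v \<in> {fst (xs ! i), snd (xs ! i)}"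
        unfolding xs by simp_all
      then show "\<exists>f\<in>set xs. v \<in> {fst f, snd f}" by blast
    next
      assume "\<exists>f\<in>set xs. v \<in> {fst f, snd f}"
      then obtain i where "i < length xs" "v \<in> {fst (xs ! i), snd (xs ! i)}"
        by (metis in_set_conv_nth)
      then have "0 < Suc i" "Suc i < length (by_left M)"
        "v \<in> {fst (by_left M ! Suc i), snd (by_left M ! Suc i)}"
        unfolding xs by simp_all
      then show "\<exists>k>0. k < length (by_left M) \<and> v \<in> {fst (by_left M ! k), snd (by_left M ! k)}"
        by blast
    qed
    also have "(\<exists>f\<in>set xs. v \<in> {fst f, snd f}) \<longleftrightarrow> v \<in> fst ` set xs \<union> snd ` set xs" for v
      by blast
    finally have vert: "(\<exists>k>0. k < length (by_left M) \<and> v \<in> {fst (by_left M ! k), snd (by_left M ! k)})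
        \<longleftrightarrow> v \<in> {1..2 * Suc (Suc k)} - {1, r}" for v
      unfolding set_xs perfectD(5)[OF P] .
    have "?q > 2" using perfect_less[OF M q'] .
    moreover have "r \<le> 2 * Suc (Suc k)" using perfect_vertex[OF M e] by simp
    ultimately have "{v. ?q \<le> v \<and> v \<le> r \<and> v \<in> {1..2 * Suc (Suc k)} - {1, r}} = {?q..<r}"
      by auto
    then have "card {v. ?q \<le> v \<and> v \<le> r \<and> v \<in> {1..2 * Suc (Suc k)} - {1, r}} = r - ?q"
      by simp
    moreover have "nested (by_left M ! 0) (by_left M ! 1)"
      unfolding s open_gaps_1(1)[OF r2] using \<open>?q > 2\<close> True by simp
    ultimately show ?thesis
      unfolding st_at_def Let_def vert using s by simp
  qed
qed

text \<open>The second edge starts at the least vertex other than 1 and r. This is 3 for r = 2, when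
  the two edges are aligned. Otherwise it is 2, and comparing the right endpoint with r separates
  crossing from nesting.\<close>

lemma phi_cases:
  assumes M: "perfect {1..2 * Suc (Suc k)} M" and e: "(1, r) \<in> M" and q: "(1, q) \<in> remove_edge1 r M"
    and N: "N = put_back_edge1 r (phi (Suc k) (remove_edge1 r M))"
  shows "r = 2 \<Longrightarrow> phi (Suc (Suc k)) M = N"
    "2 < r \<Longrightarrow> r < open_gaps r q \<Longrightarrow> phi (Suc (Suc k)) M = cross_step r N"
    "2 < r \<Longrightarrow> open_gaps r q < r \<Longrightarrow> 2 < open_gaps r q \<Longrightarrow>
      phi (Suc (Suc k)) M = nest_step r (open_gaps r q) N"
proof -
  note s = second_edge[OF M e q]
  have phi: "phi (Suc (Suc k)) M = (if crossed (1, r) (open_gaps r 1, open_gaps r q) then cross_step r N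
      else if nested (1, r) (open_gaps r 1, open_gaps r q) then nest_step r (open_gaps r q) N else N)"
    by (simp only: phi.simps Let_def s fst_conv snd_conv N)
  show "r = 2 \<Longrightarrow> phi (Suc (Suc k)) M = N"
    using open_gaps_1(2) unfolding phi by auto
  show "2 < r \<Longrightarrow> r < open_gaps r q \<Longrightarrow> phi (Suc (Suc k)) M = cross_step r N"
    using open_gaps_1(1) unfolding phi by simp
  show "2 < r \<Longrightarrow> open_gaps r q < r \<Longrightarrow> 2 < open_gaps r q \<Longrightarrow>
      phi (Suc (Suc k)) M = nest_step r (open_gaps r q) N"
    using open_gaps_1(1) unfolding phi by simp
qed


subsection \<open>Induction on the number of edges\<close>

text \<open>The induction hypotheses are premises so that the same analysis serves the induction for
  \<open>phi_perfect\<close> and, once that is available, the injectivity proof.\<close>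

lemma phi_step:
  assumes M: "perfect {1..2 * Suc (Suc k)} M"
    and IH: "\<And>M. perfect {1..2 * Suc k} M \<Longrightarrow> perfect {1..2 * Suc k} (phi (Suc k) M)"
      "\<And>M a. perfect {1..2 * Suc k} M \<Longrightarrow> (1, a) \<in> M \<Longrightarrow> (1, a) \<in> phi (Suc k) M"
      "\<And>M. perfect {1..2 * Suc k} M \<Longrightarrow> ne (phi (Suc k) M) = st M"
    and e: "(1, r) \<in> M"
  defines "N \<equiv> put_back_edge1 r (phi (Suc k) (remove_edge1 r M))"
  obtains q where "perfect {1..2 * Suc (Suc k)} N" "(1, r) \<in> N"
    "r = 2 \<and> phi (Suc (Suc k)) M = N \<or>
     2 < r \<and> r < q \<and> (2, q) \<in> N \<and> phi (Suc (Suc k)) M = cross_step r N \<or>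
     2 < r \<and> q < r \<and> (2, q) \<in> N \<and> phi (Suc (Suc k)) M = nest_step r q N"
    "st M = (if r = 2 then 0 else r - q) + ne (N - {(1, r)})"
proof -
  let ?M1 = "remove_edge1 r M"
  have r: "2 \<le> r" "r \<le> 2 * Suc (Suc k)"
    using perfect_less[OF M e] perfect_vertex[OF M e] by auto
  have M1: "perfect {1..2 * Suc k} ?M1" by (rule perfect_remove_edge1(1)[OF M e])
  obtain a where a: "(1, a) \<in> ?M1" by (rule perfect_first_edge[OF M1])
  note put = perfect_put_back[OF IH(1)[OF M1] r, folded N_def]
  have eN: "(1, r) \<in> N" unfolding N_def put_back_edge1_eq by simp
  let ?q = "open_gaps r a"
  have "map_prod (open_gaps r) (open_gaps r) (1, a) \<in> N"
    using IH(2)[OF M1 a] unfolding N_def put_back_edge1_eq relabel_def by blast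
  \<comment> \<open>Here the invariant on the edge at 1 enters: the second edge of \<open>M\<close>
    is still an edge of \<open>N\<close>.\<close>
  then have q: "(2, ?q) \<in> N" if "2 < r" using open_gaps_1(1)[OF that] by simp
  have "?q \<noteq> r" if "2 < r"
    using perfect_snd_unique[OF put(1) q[OF that], of 1] eN by auto
  then consider "r = 2" | "2 < r" "r < ?q" | "2 < r" "?q < r" using r(1) by fastforce
  then have "r = 2 \<and> phi (Suc (Suc k)) M = N \<or>
     2 < r \<and> r < ?q \<and> (2, ?q) \<in> N \<and> phi (Suc (Suc k)) M = cross_step r N \<or>
     2 < r \<and> ?q < r \<and> (2, ?q) \<in> N \<and> phi (Suc (Suc k)) M = nest_step r ?q N"
  proof cases
    case 1
    then show ?thesis using phi_cases(1)[OF M e a meta_eq_to_obj_eq[OF N_def]] by blast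
  next
    case 2
    then show ?thesis using phi_cases(2)[OF M e a meta_eq_to_obj_eq[OF N_def]] q by blast
  next
    case 3
    then show ?thesis
      using phi_cases(3)[OF M e a meta_eq_to_obj_eq[OF N_def]] q perfect_less[OF put(1) q] by blast
  qed
  moreover have "st M = (if r = 2 then 0 else r - ?q) + ne (N - {(1, r)})"
    using st_remove_edge1[OF M e] st_at_0[OF M e a] r(1) put(3) IH(3)[OF M1] by simp
  ultimately show thesis using that[OF put(1) eN] by blast
qed

text \<open>The middle conjunct is the invariant that makes the induction go through. Both steps
  keep (1, r), because the new vertex before r and the deleted vertex 2 compensate each other in its
  numbering.\<close>

lemma phi_perfect:
  assumes "perfect {1..2 * Suc k} M"
  shows "perfect {1..2 * Suc k} (phi (Suc k) M) \<and> (\<forall>a. (1, a) \<in> M \<longrightarrow> (1, a) \<in> phi (Suc k) M)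
    \<and> ne (phi (Suc k) M) = st M"
  using assms
proof (induction k arbitrary: M)
  case 0
  have "card M = 1" using perfect_card[OF 0] by simp
  then obtain f where "M = {f}" by (rule card_1_singletonE)
  then have "{p \<in> M \<times> M. nested (fst p) (snd p)} = {}" using not_nested_self by auto
  then have "ne M = 0" unfolding ne_alt by (simp only: card.empty)
  moreover have "st M = 0" using \<open>card M = 1\<close> by (simp add: st_def)
  ultimately show ?case using 0 by simp
next
  case (Suc k)
  note M = Suc.prems
  obtain r where e: "(1, r) \<in> M" by (rule perfect_first_edge[OF M])
  have IH: "perfect {1..2 * Suc k} (phi (Suc k) M)" "(1, a) \<in> M \<Longrightarrow> (1, a) \<in> phi (Suc k) M"
    "ne (phi (Suc k) M) = st M" if "perfect {1..2 * Suc k} M" for M a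
    using Suc.IH[OF that] by blast+
  define N where "N = put_back_edge1 r (phi (Suc k) (remove_edge1 r M))"
  obtain q where N: "perfect {1..2 * Suc (Suc k)} N" "(1, r) \<in> N"
    and cases: "r = 2 \<and> phi (Suc (Suc k)) M = N \<or>
      2 < r \<and> r < q \<and> (2, q) \<in> N \<and> phi (Suc (Suc k)) M = cross_step r N \<or>
      2 < r \<and> q < r \<and> (2, q) \<in> N \<and> phi (Suc (Suc k)) M = nest_step r q N"
    and st: "st M = (if r = 2 then 0 else r - q) + ne (N - {(1, r)})"
    by (rule phi_step[OF M IH e, folded N_def])
  have "perfect {1..2 * Suc (Suc k)} (phi (Suc (Suc k)) M) \<and> (1, r) \<in> phi (Suc (Suc k)) M
    \<and> ne (phi (Suc (Suc k)) M) = st M"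
    using cases
  proof (elim disjE conjE)
    assume r: "r = 2" and phi: "phi (Suc (Suc k)) M = N"
    \<comment> \<open>The edge (1, 2) contains no edge, and no edge contains it because 1 is the
      smallest vertex. It contributes no nesting.\<close>
    define X where "X = N - {(1, r)}"
    have X: "N = insert (1, r) X" "(1, r) \<notin> X" using N(2) by (auto simp: X_def)
    have "finite X" using perfect_finite[OF N(1)] by (simp add: X_def)
    moreover have "{f \<in> X. nested (1, r) f} = {}" unfolding r by auto
    moreover have "{f \<in> X. nested f (1, r)} = {}"
      using perfect_vertex[OF N(1)] unfolding X_def by fastforce
    ultimately have "ne N = ne X" using ne_insert[OF _ X(2)] unfolding X(1) by (simp only: card.empty)
    then show ?thesis using N st r unfolding phi X_def by simp
  next
    assume r: "2 < r" "r < q" and q: "(2, q) \<in> N" and phi: "phi (Suc (Suc k)) M = cross_step r N"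
    show ?thesis
      using cross_step_matching[OF N q r(2)] st r unfolding phi by simp
  next
    assume r: "2 < r" "q < r" and q: "(2, q) \<in> N" and phi: "phi (Suc (Suc k)) M = nest_step r q N"
    show ?thesis
      using nest_step_matching[OF N q r(2)] st r unfolding phi by simp
  qed
  \<comment> \<open>Since (1, r) is the only edge starting at 1, the invariant for r is the
    invariant for all a.\<close>
  then show ?case using perfect_fst_unique[OF M e] by blast
qed

lemma phi_inject:
  assumes "perfect {1..2 * Suc k} M" "perfect {1..2 * Suc k} M'" "phi (Suc k) M = phi (Suc k) M'"
  shows "M = M'"
  using assms
proof (induction k arbitrary: M M')
  case 0
  then show ?case by simp
next
  case (Suc k)
  note M = Suc.prems(1) and M' = Suc.prems(2) and eq = Suc.prems(3)
  let ?P = "phi (Suc (Suc k)) M"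
  have P: "perfect {1..2 * Suc (Suc k)} ?P" using phi_perfect[OF M] by blast
  have IH: "perfect {1..2 * Suc k} (phi (Suc k) M)" "(1, a) \<in> M \<Longrightarrow> (1, a) \<in> phi (Suc k) M"
    "ne (phi (Suc k) M) = st M" if "perfect {1..2 * Suc k} M" for M a
    using phi_perfect[OF that] by blast+
  obtain r where r: "(1, r) \<in> M" "2 \<le> r" "r \<le> 2 * Suc (Suc k)" by (rule perfect_first_edge[OF M])
  obtain r' where r': "(1, r') \<in> M'" by (rule perfect_first_edge[OF M'])
  have "(1, r) \<in> ?P" "(1, r') \<in> ?P" using phi_perfect[OF M] phi_perfect[OF M'] r(1) r' eq by simp_all
  \<comment> \<open>The common image contains the first edges of both matchings, hence these
    coincide.\<close>
  then have "r' = r" by (rule perfect_fst_unique[OF P, symmetric])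
  with r' have e': "(1, r) \<in> M'" by simp
  define N where "N = put_back_edge1 r (phi (Suc k) (remove_edge1 r M))"
  define N' where "N' = put_back_edge1 r (phi (Suc k) (remove_edge1 r M'))"
  obtain q where N: "perfect {1..2 * Suc (Suc k)} N" "(1, r) \<in> N"
    and cases: "r = 2 \<and> ?P = N \<or>
      2 < r \<and> r < q \<and> (2, q) \<in> N \<and> ?P = cross_step r N \<or>
      2 < r \<and> q < r \<and> (2, q) \<in> N \<and> ?P = nest_step r q N"
    and "st M = (if r = 2 then 0 else r - q) + ne (N - {(1, r)})"
    by (rule phi_step[OF M IH r(1), folded N_def])
  obtain q' where N': "perfect {1..2 * Suc (Suc k)} N'" "(1, r) \<in> N'"
    and cases': "r = 2 \<and> ?P = N' \<or>
      2 < r \<and> r < q' \<and> (2, q') \<in> N' \<and> ?P = cross_step r N' \<or>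
      2 < r \<and> q' < r \<and> (2, q') \<in> N' \<and> ?P = nest_step r q' N'"
    and "st M' = (if r = 2 then 0 else r - q') + ne (N' - {(1, r)})"
    by (rule phi_step[OF M' IH e', folded N'_def eq])
  have cross: "\<exists>y. (r - 1, y) \<in> ?P"
    if "?P = cross_step r X" "perfect {1..2 * Suc (Suc k)} X" "(1, r) \<in> X" "(2, x) \<in> X" "r < x" for X x
    using cross_step_matching(3)[OF that(2-5)] that(1) by simp
  have nest: "\<exists>y. (y, r - 1) \<in> ?P"
    if "?P = nest_step r x X" "perfect {1..2 * Suc (Suc k)} X" "(1, r) \<in> X" "(2, x) \<in> X" "x < r" for X x
    using nest_step_matching(3)[OF that(2-5)] that(1) by simp
  \<comment> \<open>After a crossing step r - 1 is a left endpoint, after a nesting step a right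
    endpoint. This rules out the two mixed cases below. A mixture with the aligned case cannot
    occur, since r is the same on both sides.\<close>
  have excl: "\<not> ((\<exists>y. (r - 1, y) \<in> ?P) \<and> (\<exists>y. (y, r - 1) \<in> ?P))"
    using perfect_fst_snd[OF P] by blast
  consider "r = 2" "?P = N" "?P = N'"
    | "r < q" "(2, q) \<in> N" "?P = cross_step r N" "r < q'" "(2, q') \<in> N'" "?P = cross_step r N'"
    | "q < r" "(2, q) \<in> N" "?P = nest_step r q N" "q' < r" "(2, q') \<in> N'" "?P = nest_step r q' N'"
    | "r < q" "(2, q) \<in> N" "?P = cross_step r N" "q' < r" "(2, q') \<in> N'" "?P = nest_step r q' N'"
    | "q < r" "(2, q) \<in> N" "?P = nest_step r q N" "r < q'" "(2, q') \<in> N'" "?P = cross_step r N'"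
    using cases cases' by (elim disjE conjE) simp_all
  then have "N = N'"
  proof cases
    case 1
    then show ?thesis by simp
  next
    case 2
    then show ?thesis using cross_step_inject[OF N 2(2,1) N' 2(5,4)] by simp
  next
    case 3
    then show ?thesis using nest_step_inject[OF N 3(2,1) N' 3(5,4)] by simp
  next
    case 4
    then show ?thesis using cross[OF 4(3) N 4(2,1)] nest[OF 4(6) N' 4(5,4)] excl by simp
  next
    case 5
    then show ?thesis using nest[OF 5(3) N 5(2,1)] cross[OF 5(6) N' 5(5,4)] excl by simp
  qed
  note R = perfect_remove_edge1[OF M r(1)] and R' = perfect_remove_edge1[OF M' e']
  have "phi (Suc k) (remove_edge1 r M) = phi (Suc k) (remove_edge1 r M')"
    using put_back_edge1_inject[OF IH(1)[OF R(1)] IH(1)[OF R'(1)] r(2,3)] \<open>N = N'\<close>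
    unfolding N_def N'_def by simp
  then have "remove_edge1 r M = remove_edge1 r M'" by (rule Suc.IH[OF R(1) R'(1)])
  then show ?case using R(2) R'(2) by metis
qed

theorem theorem2:
  fixes n :: nat
  assumes "n \<ge> 1"
  shows "bij_betw (phi n) (matchings n) (matchings n) \<and>
         (\<forall>M \<in> matchings n. ne (phi n M) = st M)"
proof -
  obtain k where n: "n = Suc k" using assms by (cases n) auto
  have "phi n ` matchings n \<subseteq> matchings n"
    using phi_perfect unfolding n by (auto simp only: matchings_iff_perfect)
  moreover have inj: "inj_on (phi n) (matchings n)"
    using phi_inject unfolding n by (intro inj_onI) (simp only: matchings_iff_perfect)
  ultimately have "phi n ` matchings n = matchings n"
    by (intro endo_inj_surj finite_matchings)
  then have "bij_betw (phi n) (matchings n) (matchings n)"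
    using inj by (simp add: bij_betw_def)
  moreover have "\<forall>M \<in> matchings n. ne (phi n M) = st M"
    using phi_perfect unfolding n by (auto simp only: matchings_iff_perfect)
  ultimately show ?thesis ..
qed

end
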